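(* There exist universal constants $C_0>0$ and $c>0$ such that the following holds. Let $n/\mu\ge\max\{4,r\}$ and $\mu\ge12\log(12n)$. For $\lambda^\star>0$, let $\Omega(\lambda^\star,\mu,r)=\{(\boldsymbol{\Lambda}^\star,\boldsymbol{U}^\star):\boldsymbol{\Lambda}^\star=\lambda^\star\boldsymbol{I}_r,\ \boldsymbol{U}^\star\in\mathbb{K}_{r,\mu}\}$ and, for each such pair, let $\mathbb{E}_{\boldsymbol{\Lambda}^\star,\boldsymbol{U}^\star}$ denote expectation when observing $\boldsymbol{Y}=\boldsymbol{U}^\star\boldsymbol{\Lambda}^\star{\boldsymbol{U}^\star}^\top+\boldsymbol{W}$ with $\boldsymbol{W}$ symmetric having independent $N(0,\sigma^2)$ entries on and above the diagonal. Then for any $0<\lambda^\star\le(6\sqrt{C_0})^{-1}\sigma\sqrt n$ and all sufficiently large $n$, $$\inf_{\widehat{\boldsymbol{U}}}\ \sup_{(\boldsymbol{\Lambda}^\star,\boldsymbol{U}^\star)\in\Omega(\lambda^\star,\mu,r)}\mathbb{E}_{\boldsymbol{\Lambda}^\star,\boldsymbol{U}^\star}\,d_{2,\infty}(\widehat{\boldsymbol{U}},\boldsymbol{U}^\star)\ \ge\ c\left(\frac{\sigma\sqrt r}{\lambda^\star}\wedge\sqrt{\frac{\mu r}{n\log(n/\mu)}}\right),$$ where the infimum is over all estimators $\widehat{\boldsymbol{U}}\in\mathbb{R}^{n\times r}$ (measurable functions of $\boldsymbol{Y}$).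
   Context: $\mathbb{K}_{r,\mu}=\{\boldsymbol{U}\in\mathbb{R}^{n\times r}:\boldsymbol{U}^\top\boldsymbol{U}=\boldsymbol{I}_r,\ \|\boldsymbol{U}\|_{2,\infty}\le\sqrt{r\mu/n}\}$, where $\|\cdot\|_{2,\infty}$ is the maximum row Euclidean norm. $d_{2,\infty}(\boldsymbol{U}_1,\boldsymbol{U}_2)=\min_{\boldsymbol{\Gamma}\in\mathbb{O}_r}\|\boldsymbol{U}_2-\boldsymbol{U}_1\boldsymbol{\Gamma}\|_{2,\infty}$. $a\wedge b=\min\{a,b\}$. *)

theory Defs
  imports "HOL-Probability.Probability"
begin

text \<open>Matrices are functions on index pairs; an m x k matrix is only read
  at indices (i,j) with i < m and j < k.\<close>
type_synonym mat = "nat \<times> nat \<Rightarrow> real"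

definition norm_2inf :: "nat \<Rightarrow> nat \<Rightarrow> mat \<Rightarrow> real" where
  "norm_2inf n r A = Max ((\<lambda>i. sqrt (\<Sum>j<r. (A (i, j))\<^sup>2)) ` {..<n})"

definition orthonormal_cols :: "nat \<Rightarrow> nat \<Rightarrow> mat \<Rightarrow> bool" where
  "orthonormal_cols n r A \<longleftrightarrow>
     (\<forall>a<r. \<forall>b<r. (\<Sum>k<n. A (k, a) * A (k, b)) = (if a = b then 1 else 0))"

definition orth_group :: "nat \<Rightarrow> mat set" where
  "orth_group r = {G. orthonormal_cols r r G}"

definition mat_mult :: "nat \<Rightarrow> mat \<Rightarrow> mat \<Rightarrow> mat" where
  "mat_mult r A B = (\<lambda>(i, j). \<Sum>k<r. A (i, k) * B (k, j))"

definition K_set :: "nat \<Rightarrow> nat \<Rightarrow> real \<Rightarrow> mat set" where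
  "K_set n r \<mu> = {U. orthonormal_cols n r U \<and> norm_2inf n r U \<le> sqrt (r * \<mu> / n)}"

text \<open>d_{2,inf}(U1,U2) = min over orthogonal Gamma of ||U2 - U1 Gamma||_{2,inf}
  (the minimum is attained by compactness, so it equals the infimum).\<close>
definition d_2inf :: "nat \<Rightarrow> nat \<Rightarrow> mat \<Rightarrow> mat \<Rightarrow> real" where
  "d_2inf n r U1 U2 =
     Inf ((\<lambda>G. norm_2inf n r (\<lambda>ij. U2 ij - mat_mult r U1 G ij)) ` orth_group r)"

text \<open>Signal U Lambda U^T with Lambda = lam * I_r.\<close>
definition signal :: "nat \<Rightarrow> real \<Rightarrow> mat \<Rightarrow> mat" where
  "signal r lam U = (\<lambda>(i, j). lam * (\<Sum>k<r. U (i, k) * U (j, k)))"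

definition noise_space :: "nat \<Rightarrow> real \<Rightarrow> (nat \<times> nat \<Rightarrow> real) measure" where
  "noise_space n \<sigma> =
     PiM {(i, j). i \<le> j \<and> j < n} (\<lambda>_. density lborel (normal_density 0 \<sigma>))"

definition observe :: "nat \<Rightarrow> mat \<Rightarrow> (nat \<times> nat \<Rightarrow> real) \<Rightarrow> mat" where
  "observe n M w =
     restrict (\<lambda>(i, j). M (i, j) + w (min i j, max i j)) ({..<n} \<times> {..<n})"

definition obs_space :: "nat \<Rightarrow> mat measure" where
  "obs_space n = PiM ({..<n} \<times> {..<n}) (\<lambda>_. borel)"

definition est_space :: "nat \<Rightarrow> nat \<Rightarrow> mat measure" where
  "est_space n r = PiM ({..<n} \<times> {..<r}) (\<lambda>_. borel)"

definition risk :: "nat \<Rightarrow> nat \<Rightarrow> real \<Rightarrow> real \<Rightarrow> (mat \<Rightarrow> mat) \<Rightarrow> mat \<Rightarrow> ennreal" where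
  "risk n r \<sigma> lam Uhat U =
     (\<integral>\<^sup>+ w. ennreal (d_2inf n r (Uhat (observe n (signal r lam U) w)) U) \<partial>noise_space n \<sigma>)"

end

theory Submission
  imports Defs
begin

text \<open>Stack an identity block and \<open>b\<close> orthogonal \<open>r \<times> r\<close> matrices and divide by \<open>sqrt (b + 1)\<close>. The
  result has orthonormal columns, and all its nonzero rows have norm \<open>1 / sqrt (b + 1)\<close>, so it is
  incoherent as soon as \<open>(b + 1) r \<ge> n / \<mu>\<close>. The orthogonal group contains \<open>exp (c r\<^sup>2)\<close> matrices at
  mutual squared Frobenius distance at least \<open>r / 48\<close>, which yields \<open>exp (c b r\<^sup>2)\<close> hypotheses.
  An estimate within \<open>1 / (32 sqrt (b + 1))\<close> of two of them must be close on every block: the identity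
  block pins down the unknown rotation, and then no other block can differ.
  Hence the sets of good estimates are disjoint. The likelihood ratio of each hypothesis against pure
  noise has second moment at most \<open>exp (\<lambda>\<^sup>2 r / \<sigma>\<^sup>2)\<close>, so the hypotheses cannot be told apart once
  \<open>b r\<close> is a large multiple of \<open>\<lambda>\<^sup>2 / \<sigma>\<^sup>2 + n / \<mu>\<close>; the conditions on \<open>\<lambda>\<close> and \<open>\<mu>\<close> leave room for these
  rows. The bound obtained is of order \<open>1 / sqrt b\<close>, which is \<open>min (\<sigma> sqrt r / \<lambda>) (sqrt (\<mu> r / n))\<close> up
  to a constant.\<close>

section \<open>Matrices with orthonormal columns\<close>

lemma orthonormal_colsD:
  "orthonormal_cols n r A \<Longrightarrow> a < r \<Longrightarrow> b < r \<Longrightarrow>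
    (\<Sum>k<n. A (k, a) * A (k, b)) = (if a = b then 1 else 0)"
  by (simp add: orthonormal_cols_def)

lemma orthonormal_cols_isometry:
  assumes "orthonormal_cols n r A"
  shows "(\<Sum>i<n. (\<Sum>k<r. A (i, k) * x k)\<^sup>2) = (\<Sum>k<r. (x k)\<^sup>2)"
proof -
  have "(\<Sum>i<n. (\<Sum>k<r. A (i, k) * x k)\<^sup>2)
      = (\<Sum>i<n. \<Sum>k<r. \<Sum>l<r. x k * x l * (A (i, k) * A (i, l)))"
    by (simp add: power2_eq_square sum_product mult_ac)
  also have "\<dots> = (\<Sum>k<r. \<Sum>l<r. \<Sum>i<n. x k * x l * (A (i, k) * A (i, l)))"
    by (subst sum.swap, rule sum.cong[OF refl], rule sum.swap)
  also have "\<dots> = (\<Sum>k<r. \<Sum>l<r. x k * x l * (if k = l then 1 else 0))"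
    by (intro sum.cong refl) (simp add: sum_distrib_left[symmetric] orthonormal_colsD[OF assms])
  also have "\<dots> = (\<Sum>k<r. (x k)\<^sup>2)"
    by (simp add: power2_eq_square if_distrib cong: if_cong)
  finally show ?thesis .
qed

text \<open>For orthonormal columns: coordinate \<open>l\<close> of the \<open>k\<close>-th unit
  vector minus its projection onto the span of the first \<open>i\<close> columns of
  \<open>A\<close>.\<close>

definition col_residual :: "nat \<Rightarrow> mat \<Rightarrow> nat \<Rightarrow> nat \<Rightarrow> real" where
  "col_residual i A k l = (if l = k then 1 else 0) - (\<Sum>a<i. A (k, a) * A (l, a))"

lemma col_residual_orthogonal:
  assumes "orthonormal_cols n i A" "k < n" "b < i"
  shows "(\<Sum>l<n. A (l, b) * col_residual i A k l) = 0"
proof -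
  have "(\<Sum>l<n. \<Sum>a<i. A (k, a) * (A (l, b) * A (l, a)))
      = (\<Sum>a<i. A (k, a) * (if b = a then 1 else 0))"
    by (subst sum.swap)
       (intro sum.cong refl, simp add: sum_distrib_left[symmetric] orthonormal_colsD[OF assms(1)] assms)
  also have "\<dots> = A (k, b)"
    using assms(3) by (simp add: if_distrib cong: if_cong)
  finally have *: "(\<Sum>l<n. A (l, b) * (\<Sum>a<i. A (k, a) * A (l, a))) = A (k, b)"
    by (simp add: sum_distrib_left mult_ac)
  show ?thesis
    using assms(2) unfolding col_residual_def right_diff_distrib sum_subtractf *
    by (simp add: if_distrib cong: if_cong)
qed

text \<open>Pythagoras: the residual is orthogonal to the projection, so its squared norm is its
  inner product with the unit vector, that is, its own \<open>k\<close>-th coordinate.\<close>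

lemma col_residual_norm:
  assumes "orthonormal_cols n i A" "k < n"
  shows "(\<Sum>l<n. (col_residual i A k l)\<^sup>2) = 1 - (\<Sum>a<i. (A (k, a))\<^sup>2)"
proof -
  have "(\<Sum>l<n. (col_residual i A k l)\<^sup>2)
      = (\<Sum>l<n. (if l = k then 1 else 0) * col_residual i A k l)
        - (\<Sum>l<n. (\<Sum>a<i. A (k, a) * A (l, a)) * col_residual i A k l)"
    by (simp add: sum_subtractf[symmetric] left_diff_distrib[symmetric] power2_eq_square
        flip: col_residual_def)
  also have "(\<Sum>l<n. (\<Sum>a<i. A (k, a) * A (l, a)) * col_residual i A k l)
      = (\<Sum>a<i. A (k, a) * (\<Sum>l<n. A (l, a) * col_residual i A k l))"
    unfolding sum_distrib_right sum_distrib_left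
    by (subst sum.swap) (simp add: mult_ac)
  also have "\<dots> = 0"
    by (simp add: col_residual_orthogonal[OF assms])
  also have "(\<Sum>l<n. (if l = k then 1 else 0) * col_residual i A k l) = col_residual i A k k"
    using assms(2) by (simp add: if_distrib[where f="\<lambda>c. c * _"] cong: if_cong)
  finally show ?thesis by (simp add: col_residual_def power2_eq_square)
qed

lemma sum_squares_orthonormal_cols:
  assumes "orthonormal_cols n r A"
  shows "(\<Sum>k<n. \<Sum>a<r. (A (k, a))\<^sup>2) = r"
proof -
  have "(\<Sum>k<n. \<Sum>a<r. (A (k, a))\<^sup>2) = (\<Sum>a<r. \<Sum>k<n. A (k, a) * A (k, a))"
    by (subst sum.swap) (simp add: power2_eq_square)
  also have "\<dots> = r"
    by (simp add: orthonormal_colsD[OF assms])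
  finally show ?thesis .
qed

text \<open>Trace count: the squared residuals of all unit vectors add up to
  \<open>r - r = 0\<close>, so every residual, a row of \<open>I - A A^T\<close>, vanishes.\<close>

lemma orthonormal_rows_of_square:
  assumes A: "orthonormal_cols r r A" and "k < r" "l < r"
  shows "(\<Sum>a<r. A (k, a) * A (l, a)) = (if k = l then 1 else 0)"
proof -
  have "(\<Sum>k<r. \<Sum>l<r. (col_residual r A k l)\<^sup>2) = (\<Sum>k<r. 1 - (\<Sum>a<r. (A (k, a))\<^sup>2))"
    by (simp add: col_residual_norm[OF A])
  also have "\<dots> = 0"
    by (simp add: sum_subtractf sum_squares_orthonormal_cols[OF A])
  finally have "(\<Sum>l<r. (col_residual r A k l)\<^sup>2) = 0"
    using \<open>k < r\<close> by (subst (asm) sum_nonneg_eq_0_iff) (auto intro: sum_nonneg)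
  then have "col_residual r A k l = 0"
    using \<open>l < r\<close> by (subst (asm) sum_nonneg_eq_0_iff) auto
  then show ?thesis by (auto simp: col_residual_def split: if_splits)
qed

definition transpose_mat :: "mat \<Rightarrow> mat" where "transpose_mat A = (\<lambda>(i, j). A (j, i))"

lemma orthonormal_transpose_mat:
  "orthonormal_cols r r A \<Longrightarrow> orthonormal_cols r r (transpose_mat A)"
  using orthonormal_rows_of_square by (simp add: orthonormal_cols_def transpose_mat_def)

text \<open>The squared row norms total \<open>i < n\<close>, so some row has norm below 1. The
  corresponding unit vector has a nonzero residual, and normalising that gives the new
  column.\<close>

lemma orthonormal_cols_extend1:
  assumes A: "orthonormal_cols n i A" and "i < n"
  shows "\<exists>B. orthonormal_cols n (Suc i) B \<and> (\<forall>k. \<forall>a<i. B (k, a) = A (k, a))"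
proof -
  have "\<exists>k<n. (\<Sum>a<i. (A (k, a))\<^sup>2) < 1"
  proof (rule ccontr)
    assume "\<not> ?thesis"
    then have "(\<Sum>k<n. 1) \<le> (\<Sum>k<n. \<Sum>a<i. (A (k, a))\<^sup>2)"
      by (intro sum_mono) (meson lessThan_iff not_less)
    then show False using \<open>i < n\<close> by (simp add: sum_squares_orthonormal_cols[OF A])
  qed
  then obtain k where k: "k < n" "(\<Sum>a<i. (A (k, a))\<^sup>2) < 1" by blast
  define s where "s = (\<Sum>l<n. (col_residual i A k l)\<^sup>2)"
  have s: "s > 0" using k by (simp add: s_def col_residual_norm[OF A])
  define B where "B = (\<lambda>(l, a). if a < i then A (l, a) else col_residual i A k l / sqrt s)"
  have 1: "(\<Sum>l<n. A (l, a) * (col_residual i A k l / sqrt s)) = 0" if "a < i" for a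
    using col_residual_orthogonal[OF A k(1) that]
    by (simp add: sum_divide_distrib[symmetric])
  have 2: "(\<Sum>l<n. (col_residual i A k l / sqrt s) * A (l, a)) = 0" if "a < i" for a
    using 1[OF that] by (simp add: mult_ac)
  have 3: "(\<Sum>l<n. (col_residual i A k l / sqrt s) * (col_residual i A k l / sqrt s)) = 1"
  proof -
    have "(\<Sum>l<n. (col_residual i A k l / sqrt s) * (col_residual i A k l / sqrt s)) = s / (sqrt s * sqrt s)"
      by (simp add: s_def sum_divide_distrib power2_eq_square)
    then show ?thesis using s by simp
  qed
  have "orthonormal_cols n (Suc i) B"
    unfolding orthonormal_cols_def B_def
    using 1 2 3 A by (auto simp: less_Suc_eq orthonormal_cols_def)
  then show ?thesis by (intro exI[of _ B]) (auto simp: B_def)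
qed

lemma orthonormal_cols_extend:
  assumes "orthonormal_cols n i A" "i \<le> j" "j \<le> n"
  shows "\<exists>B. orthonormal_cols n j B \<and> (\<forall>k. \<forall>a<i. B (k, a) = A (k, a))"
  using assms(2,3)
proof (induction j rule: dec_induct)
  case base
  then show ?case using assms(1) by auto
next
  case (step j)
  then obtain B where B: "orthonormal_cols n j B" "\<forall>k. \<forall>a<i. B (k, a) = A (k, a)" by auto
  obtain C where "orthonormal_cols n (Suc j) C" "\<forall>k. \<forall>a<j. C (k, a) = B (k, a)"
    using orthonormal_cols_extend1[OF B(1)] step.prems by auto
  then show ?case using B(2) step.hyps by (intro exI[of _ C]) auto
qed

definition orth_completion :: "nat \<Rightarrow> nat \<Rightarrow> mat \<Rightarrow> mat" where
  "orth_completion n i A =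
     (SOME B. orthonormal_cols n n B \<and> (\<forall>k. \<forall>a<i. B (k, a) = A (k, a)))"

lemma orth_completion:
  assumes "orthonormal_cols n i A" "i \<le> n"
  shows "orthonormal_cols n n (orth_completion n i A)"
    and "a < i \<Longrightarrow> orth_completion n i A (k, a) = A (k, a)"
  using someI_ex[OF orthonormal_cols_extend[OF assms order_refl]]
  by (auto simp: orth_completion_def)

section \<open>A packing of the orthogonal group\<close>

lemma sum_add_square_le:
  fixes f g :: "'a \<Rightarrow> real"
  shows "(\<Sum>i\<in>A. (f i + g i)\<^sup>2) \<le> 2 * (\<Sum>i\<in>A. (f i)\<^sup>2) + 2 * (\<Sum>i\<in>A. (g i)\<^sup>2)"
proof -
  have "(f i + g i)\<^sup>2 \<le> 2 * (f i)\<^sup>2 + 2 * (g i)\<^sup>2" for i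
    using zero_le_power2[of "f i - g i"] by (simp add: power2_eq_square algebra_simps)
  then show ?thesis
    unfolding sum_distrib_left sum.distrib[symmetric] by (intro sum_mono)
qed

lemma sum_diff_square_le:
  fixes f g :: "'a \<Rightarrow> real"
  shows "(\<Sum>i\<in>A. (f i - g i)\<^sup>2) \<le> 2 * (\<Sum>i\<in>A. (f i)\<^sup>2) + 2 * (\<Sum>i\<in>A. (g i)\<^sup>2)"
  using sum_add_square_le[of f "\<lambda>i. - g i" A] by simp

text \<open>The set \<open>E\<close> encodes a sign vector; the offset \<open>i\<close> skips the
  columns of \<open>B\<close> already in use, which keeps the result orthogonal to them.\<close>

definition sign_comb :: "nat \<Rightarrow> nat \<Rightarrow> mat \<Rightarrow> nat set \<Rightarrow> nat \<Rightarrow> real" where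
  "sign_comb i d B E k = (\<Sum>j<d. B (k, i + j) * ((if j \<in> E then 1 else -1) / sqrt d))"

lemma sign_comb_orthogonal:
  assumes B: "orthonormal_cols n n B" and "i + d \<le> n" "a < i"
  shows "(\<Sum>k<n. B (k, a) * sign_comb i d B E k) = 0"
proof -
  have "(\<Sum>k<n. B (k, a) * sign_comb i d B E k)
      = (\<Sum>j<d. (\<Sum>k<n. B (k, a) * B (k, i + j)) * ((if j \<in> E then 1 else -1) / sqrt d))"
    unfolding sign_comb_def sum_distrib_left sum_distrib_right
    by (subst sum.swap) (simp add: mult_ac)
  also have "\<dots> = 0"
    using assms by (intro sum.neutral) (simp add: orthonormal_colsD[OF B])
  finally show ?thesis .
qed

lemma orthonormal_cols_shift:
  "orthonormal_cols n n B \<Longrightarrow> i + d \<le> n \<Longrightarrow> orthonormal_cols n d (\<lambda>(k, j). B (k, i + j))"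
  by (simp add: orthonormal_cols_def)

lemma sign_comb_norm:
  assumes "orthonormal_cols n n B" "i + d \<le> n" "0 < d"
  shows "(\<Sum>k<n. (sign_comb i d B E k)\<^sup>2) = 1"
  using orthonormal_cols_isometry[OF orthonormal_cols_shift[OF assms(1,2)],
      of "\<lambda>j. (if j \<in> E then 1 else -1) / sqrt d"] assms(3)
  by (simp add: sign_comb_def power_divide if_distrib[where f="\<lambda>x. x\<^sup>2"] cong: if_cong)

text \<open>The isometry removes \<open>B\<close>; each sign disagreement then contributes
  \<open>(2 / sqrt d)^2\<close>, so the squared distance is a rescaled Hamming distance.\<close>

lemma sign_comb_dist:
  assumes "orthonormal_cols n n B" "i + d \<le> n" "0 < d" "E \<subseteq> {..<d}" "E' \<subseteq> {..<d}"
  shows "(\<Sum>k<n. (sign_comb i d B E k - sign_comb i d B E' k)\<^sup>2) = 4 * card (sym_diff E E') / d"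
proof -
  let ?s = "\<lambda>E j. (if j \<in> E then 1 else -1 :: real) / sqrt d"
  have "(\<Sum>k<n. (sign_comb i d B E k - sign_comb i d B E' k)\<^sup>2)
      = (\<Sum>k<n. (\<Sum>j<d. B (k, i + j) * (?s E j - ?s E' j))\<^sup>2)"
    by (simp add: sign_comb_def sum_subtractf[symmetric] right_diff_distrib)
  also have "\<dots> = (\<Sum>j<d. (?s E j - ?s E' j)\<^sup>2)"
    using orthonormal_cols_isometry[OF orthonormal_cols_shift[OF assms(1,2)], of "\<lambda>j. ?s E j - ?s E' j"]
    by simp
  also have "\<dots> = (\<Sum>j<d. if j \<in> sym_diff E E' then 4 / real d else 0)"
    using assms(3) by (intro sum.cong) (auto simp: power2_eq_square divide_simps)
  also have "\<dots> = (\<Sum>j\<in>sym_diff E E'. 4 / real d)"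
  proof -
    have "{..<d} \<inter> sym_diff E E' = sym_diff E E'" using assms(4,5) by auto
    then show ?thesis by (simp only: sum.inter_restrict[OF finite_lessThan, symmetric])
  qed
  finally show ?thesis by simp
qed

text \<open>Exponential Markov inequality: with weight \<open>(1/4) ^ card Z\<close>, every counted
  set weighs at least \<open>2 powr (- d / 4)\<close>, while all subsets together weigh
  \<open>(5/4) ^ d\<close>, at most \<open>2 powr (d / 2)\<close>.\<close>

lemma card_small_subsets:
  "real (card {Z. Z \<subseteq> {..<d} \<and> 8 * card Z < d}) \<le> 2 powr (3 * real d / 4)"
proof -
  let ?S = "{Z. Z \<subseteq> {..<d} \<and> 8 * card Z < d}"
  have fin: "finite (Pow {..<d})" by simp
  have *: "2 powr (- real d / 4) \<le> (1/4) ^ card Z" if "Z \<in> ?S" for Z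
  proof -
    have "(1/4) ^ card Z = 2 powr (- 2 * real (card Z))"
      by (simp add: powr_minus powr_mult[symmetric] powr_powr[symmetric] powr_realpow power_divide
          flip: power_inverse)
    then show ?thesis using that by simp
  qed
  have "card ?S * 2 powr (- real d / 4) = (\<Sum>Z\<in>?S. 2 powr (- real d / 4))" by simp
  also have "\<dots> \<le> (\<Sum>Z\<in>?S. (1/4) ^ card Z)" by (intro sum_mono *)
  also have "\<dots> \<le> (\<Sum>Z\<in>Pow {..<d}. (1/4 :: real) ^ card Z)"
    by (intro sum_mono2 fin) auto
  also have "\<dots> = (\<Prod>j<d. 1/4 + 1)"
    by (subst prod_add) (auto intro!: sum.cong)
  also have "\<dots> = (5/4) ^ d" by simp
  also have "\<dots> \<le> (2 powr (1/2)) ^ d"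
  proof (intro power_mono)
    have "5/4 \<le> sqrt (2 :: real)" by (rule real_le_rsqrt) (simp add: power2_eq_square)
    then show "5/4 \<le> (2 :: real) powr (1/2)" by (simp add: powr_half_sqrt)
  qed simp
  also have "\<dots> = 2 powr (real d / 2)" by (simp add: powr_powr flip: powr_realpow)
  finally have "card ?S \<le> 2 powr (real d / 2) / 2 powr (- real d / 4)"
    by (simp add: field_simps)
  also have "\<dots> = 2 powr (3 * real d / 4)"
    by (simp add: powr_diff[symmetric])
  finally show ?thesis .
qed

text \<open>The centre \<open>t\<close> is arbitrary, so a member \<open>D\<close> of the ball
  replaces it: squared distances to \<open>D\<close> are below 1/2, which means fewer than
  \<open>d / 8\<close> sign disagreements, and \<open>E\<close> is recovered from its symmetric
  difference with \<open>D\<close>.\<close>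

lemma card_sign_comb_ball:
  assumes B: "orthonormal_cols n n B" and "i + d \<le> n" "0 < d"
  shows "real (card {E \<in> Pow {..<d}. (\<Sum>k<n. (sign_comb i d B E k - t k)\<^sup>2) < 1/8})
    \<le> 2 powr (3 * real d / 4)"
proof (cases "{E \<in> Pow {..<d}. (\<Sum>k<n. (sign_comb i d B E k - t k)\<^sup>2) < 1/8} = {}")
  case True
  then show ?thesis unfolding True by simp
next
  case False
  let ?S = "{E \<in> Pow {..<d}. (\<Sum>k<n. (sign_comb i d B E k - t k)\<^sup>2) < 1/8}"
  from False obtain D where D: "D \<in> ?S" by blast
  have "inj_on (\<lambda>E. sym_diff E D) ?S" by (auto simp: inj_on_def)
  moreover have "(\<lambda>E. sym_diff E D) ` ?S \<subseteq> {Z. Z \<subseteq> {..<d} \<and> 8 * card Z < d}"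
  proof (rule image_subsetI)
    fix E assume E: "E \<in> ?S"
    have "4 * card (sym_diff E D) / d
        = (\<Sum>k<n. ((sign_comb i d B E k - t k) - (sign_comb i d B D k - t k))\<^sup>2)"
      using sign_comb_dist[OF assms, of E D] E D by simp
    also have "\<dots> < 1/2"
      using sum_diff_square_le[of "\<lambda>k. sign_comb i d B E k - t k" "\<lambda>k. sign_comb i d B D k - t k" "{..<n}"]
        E D by simp
    finally have "8 * real (card (sym_diff E D)) < d" using assms(3) by (simp add: field_simps)
    then have "8 * card (sym_diff E D) < d" by linarith
    then show "sym_diff E D \<in> {Z. Z \<subseteq> {..<d} \<and> 8 * card Z < d}" using E D by auto
  qed
  moreover have "finite {Z. Z \<subseteq> {..<d} \<and> 8 * card Z < d}" by simp
  ultimately have "card ?S \<le> card {Z. Z \<subseteq> {..<d} \<and> 8 * card Z < d}"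
    by (rule card_inj_on_le)
  then show ?thesis using card_small_subsets[of d] by linarith
qed

text \<open>Orthonormal columns are chosen one after the other: the column in position \<open>i\<close> is a flat signed
  combination of \<open>d\<close> orthonormal vectors completing the columns chosen before. Lists grow at the
  front, so the head of the list is the sign set of the last column.\<close>

primrec col_tree :: "nat \<Rightarrow> nat \<Rightarrow> nat set list \<Rightarrow> mat" where
  "col_tree n d [] = (\<lambda>_. 0)"
| "col_tree n d (E # xs) = (\<lambda>(k, a). if a < length xs then col_tree n d xs (k, a)
     else sign_comb (length xs) d (orth_completion n (length xs) (col_tree n d xs)) E k)"

lemma col_tree_orthonormal:
  assumes "length xs + d \<le> n" "0 < d"
  shows "orthonormal_cols n (length xs) (col_tree n d xs)"
  using assms
proof (induction xs)
  case Nil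
  then show ?case by (simp add: orthonormal_cols_def)
next
  case (Cons E xs)
  let ?P = "col_tree n d xs" and ?i = "length xs"
  let ?B = "orth_completion n ?i ?P"
  have P: "orthonormal_cols n ?i ?P" using Cons by simp
  have B: "orthonormal_cols n n ?B" "\<And>a k. a < ?i \<Longrightarrow> ?B (k, a) = ?P (k, a)"
    using orth_completion[OF P] Cons.prems by auto
  have 1: "(\<Sum>k<n. ?P (k, a) * sign_comb ?i d ?B E k) = 0" if "a < ?i" for a
    using sign_comb_orthogonal[OF B(1), of ?i d a E] Cons.prems that by (simp add: B(2))
  have 2: "(\<Sum>k<n. sign_comb ?i d ?B E k * ?P (k, a)) = 0" if "a < ?i" for a
    using 1[OF that] by (simp add: mult_ac)
  have 3: "(\<Sum>k<n. sign_comb ?i d ?B E k * sign_comb ?i d ?B E k) = 1"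
    using sign_comb_norm[OF B(1), of ?i d E] Cons.prems by (simp add: power2_eq_square)
  show ?case
    unfolding orthonormal_cols_def
    using 1 2 3 P by (auto simp: less_Suc_eq orthonormal_cols_def)
qed

section \<open>Large deviations of the number of columns far from a target\<close>

primrec far_cols :: "nat \<Rightarrow> nat \<Rightarrow> mat \<Rightarrow> nat set list \<Rightarrow> nat" where
  "far_cols n d T [] = 0"
| "far_cols n d T (E # xs) = far_cols n d T xs +
     (if (\<Sum>k<n. (col_tree n d (E # xs) (k, length xs) - T (k, length xs))\<^sup>2) < 1/8 then 0 else 1)"

lemma far_cols_le:
  "far_cols n d T xs / 8 \<le> (\<Sum>a<length xs. \<Sum>k<n. (col_tree n d xs (k, a) - T (k, a))\<^sup>2)"
proof (induction xs)
  case (Cons E xs)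
  have "0 \<le> (\<Sum>k<n. (col_tree n d (E # xs) (k, length xs) - T (k, length xs))\<^sup>2)"
    by (intro sum_nonneg) simp
  then show ?case using Cons by (auto simp del: not_less simp: not_less)
qed simp

text \<open>Whatever the previous columns are, few sign sets bring the next column close to the target, so
  each column contributes one factor to this generating function.\<close>

lemma sum_far_cols_le:
  fixes x :: real
  assumes "m + d \<le> n" "0 < d" "0 \<le> x"
  shows "(\<Sum>xs | set xs \<subseteq> Pow {..<d} \<and> length xs = m. x ^ far_cols n d T xs)
    \<le> (2 powr (3 * real d / 4) + 2 ^ d * x) ^ m"
  using assms(1)
proof (induction m)
  case 0
  have "{xs :: nat set list. set xs \<subseteq> Pow {..<d} \<and> length xs = 0} = {[]}" by auto
  then show ?case by simp
next
  case (Suc m)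
  let ?c = "2 powr (3 * real d / 4) + 2 ^ d * x"
  let ?L = "\<lambda>m. {xs. set xs \<subseteq> Pow {..<d} \<and> length xs = m}"
  have "(\<Sum>ys\<in>?L (Suc m). x ^ far_cols n d T ys)
      = (\<Sum>xs\<in>?L m. \<Sum>E\<in>Pow {..<d}. x ^ far_cols n d T (E # xs))"
    unfolding lists_length_Suc_eq
    by (subst sum.reindex) (auto simp: inj_on_def sum.cartesian_product intro!: sum.cong)
  also have "\<dots> \<le> (\<Sum>xs\<in>?L m. x ^ far_cols n d T xs * ?c)"
  proof (rule sum_mono)
    fix xs assume xs: "xs \<in> ?L m"
    let ?B = "orth_completion n m (col_tree n d xs)"
    let ?near = "\<lambda>E. (\<Sum>k<n. (sign_comb m d ?B E k - T (k, m))\<^sup>2) < 1/8"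
    have B: "orthonormal_cols n n ?B"
      using orth_completion(1)[OF col_tree_orthonormal[of xs d n]] xs Suc.prems assms(2) by simp
    have eq: "(\<Sum>E\<in>Pow {..<d}. x ^ far_cols n d T (E # xs))
        = x ^ far_cols n d T xs * (\<Sum>E\<in>Pow {..<d}. if ?near E then 1 else x)"
      using xs unfolding sum_distrib_left by (intro sum.cong) auto
    have "(\<Sum>E\<in>Pow {..<d}. if ?near E then 1 else x)
        = card {E \<in> Pow {..<d}. ?near E} + card {E \<in> Pow {..<d}. \<not> ?near E} * x"
    proof -
      have "Pow {..<d} \<inter> {E. ?near E} = {E \<in> Pow {..<d}. ?near E}"
        "Pow {..<d} \<inter> - {E. ?near E} = {E \<in> Pow {..<d}. \<not> ?near E}" by blast+
      then show ?thesis
        by (simp only: sum.If_cases[OF finite_Pow_iff[THEN iffD2, OF finite_lessThan]] sum_constant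
            mult_1_right)
    qed
    also have "\<dots> \<le> 2 powr (3 * real d / 4) + 2 ^ d * x"
    proof (rule add_mono[OF _ mult_right_mono])
      show "real (card {E \<in> Pow {..<d}. ?near E}) \<le> 2 powr (3 * real d / 4)"
        using card_sign_comb_ball[OF B, of m d "\<lambda>k. T (k, m)"] Suc.prems assms(2) by simp
      have "card {E \<in> Pow {..<d}. \<not> ?near E} \<le> card (Pow {..<d})" by (intro card_mono) auto
      then show "real (card {E \<in> Pow {..<d}. \<not> ?near E}) \<le> 2 ^ d"
        by (simp add: card_Pow flip: of_nat_power)
    qed fact
    finally show "(\<Sum>E\<in>Pow {..<d}. x ^ far_cols n d T (E # xs)) \<le> x ^ far_cols n d T xs * ?c"
      unfolding eq using assms(3) by (intro mult_left_mono zero_le_power)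
  qed
  also have "\<dots> \<le> ?c ^ m * ?c"
    unfolding sum_distrib_right[symmetric]
    using Suc assms(3) by (intro mult_right_mono) auto
  finally show ?case by (simp only: power_Suc2)
qed

text \<open>Markov inequality for the generating function. Out of \<open>2 ^ (d * m)\<close> lists,
  those with at most half of their columns far form a fraction of at most
  \<open>2 powr (m - d * m / 8)\<close>.\<close>

lemma card_few_far_cols:
  assumes "m + d \<le> n" "0 < d"
  shows "real (card {xs. set xs \<subseteq> Pow {..<d} \<and> length xs = m \<and> 2 * far_cols n d T xs \<le> m})
    \<le> 2 powr (m + 7 * real d * m / 8)"
proof -
  let ?S = "{xs. set xs \<subseteq> Pow {..<d} \<and> length xs = m \<and> 2 * far_cols n d T xs \<le> m}"
  let ?L = "{xs. set xs \<subseteq> Pow {..<d} \<and> length xs = m}"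
  \<comment> \<open>This \<open>x\<close> makes the two summands of the base,
    \<open>2 powr (3 * d / 4)\<close> and \<open>2 ^ d * x\<close>, equal.\<close>
  define x where "x = 2 powr (- real d / 4)"
  have fin: "finite ?L" by (rule finite_lists_length_eq) simp
  have *: "2 powr (- (real d * m / 8)) \<le> x ^ far_cols n d T xs" if "xs \<in> ?S" for xs
  proof -
    have "2 * real (far_cols n d T xs) \<le> m" using that by simp
    from mult_left_mono[OF this, of "real d / 8"] show ?thesis
      by (simp add: x_def powr_powr flip: powr_realpow)
  qed
  have "card ?S * 2 powr (- (real d * m / 8)) = (\<Sum>xs\<in>?S. 2 powr (- (real d * m / 8)))" by simp
  also have "\<dots> \<le> (\<Sum>xs\<in>?S. x ^ far_cols n d T xs)" by (intro sum_mono *)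
  also have "\<dots> \<le> (\<Sum>xs\<in>?L. x ^ far_cols n d T xs)"
    by (intro sum_mono2 fin) (auto simp: x_def)
  also have "\<dots> \<le> (2 powr (3 * real d / 4) + 2 ^ d * x) ^ m"
    by (rule sum_far_cols_le) (use assms in \<open>auto simp: x_def\<close>)
  also have "2 powr (3 * real d / 4) + 2 ^ d * x = 2 powr (1 + 3 * real d / 4)"
    by (simp add: x_def powr_add[symmetric] powr_realpow[symmetric] powr_mult_base)
  also have "\<dots> ^ m = 2 powr (m + 3 * real d * m / 4)"
    by (simp add: powr_powr algebra_simps flip: powr_realpow)
  finally have "card ?S \<le> 2 powr (m + 3 * real d * m / 4) / 2 powr (- (real d * m / 8))"
    by (simp add: field_simps)
  also have "\<dots> = 2 powr ((m + 3 * real d * m / 4) - (- (real d * m / 8)))"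
    by (simp only: powr_diff)
  also have "(m + 3 * real d * m / 4) - (- (real d * m / 8)) = m + 7 * real d * m / 8"
    by (simp add: field_simps)
  finally show ?thesis .
qed

text \<open>Greedy selection: keep a point, discard the at most \<open>N\<close> points close to it,
  itself included, and recurse on the rest.\<close>

lemma ex_separated_subset:
  fixes N :: real
  assumes "finite J"
    and "\<And>x. x \<in> J \<Longrightarrow> close x x"
    and "\<And>x y. close x y \<Longrightarrow> close y x"
    and "\<And>x. x \<in> J \<Longrightarrow> card {y \<in> J. close x y} \<le> N"
  shows "\<exists>F\<subseteq>J. (\<forall>x\<in>F. \<forall>y\<in>F. x \<noteq> y \<longrightarrow> \<not> close x y) \<and> card J \<le> N * card F"
  using assms(1,2,4)
proof (induction J rule: finite_psubset_induct)
  case (psubset J)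
  show ?case
  proof (cases "J = {}")
    case False
    then obtain x where x: "x \<in> J" by blast
    define K where "K = J - {y \<in> J. close x y}"
    have "card {z \<in> K. close y z} \<le> N" if "y \<in> K" for y
    proof -
      have "card {z \<in> K. close y z} \<le> card {z \<in> J. close y z}"
        using psubset.hyps by (intro card_mono) (auto simp: K_def)
      also have "\<dots> \<le> N" using psubset.prems(2) that by (auto simp: K_def)
      finally show ?thesis by simp
    qed
    moreover have "K \<subset> J" using x psubset.prems(1) by (auto simp: K_def)
    ultimately obtain F where F: "F \<subseteq> K" "\<forall>x\<in>F. \<forall>y\<in>F. x \<noteq> y \<longrightarrow> \<not> close x y"
      "card K \<le> N * card F"
      using psubset.IH[of K] psubset.prems(1) by (auto simp: K_def)
    have "finite F" using F(1) psubset.hyps by (auto simp: K_def intro: finite_subset)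
    moreover have "x \<notin> F" using F(1) x psubset.prems(1) by (auto simp: K_def)
    moreover have "card J = card {y \<in> J. close x y} + card K"
      unfolding K_def using psubset.hyps
        card_mono[of J "{y \<in> J. close x y}"]
      by (simp add: card_Diff_subset)
    ultimately have "card J \<le> N * card (insert x F)"
      using F(3) psubset.prems(2)[OF x] by (simp add: algebra_simps)
    moreover have "\<forall>y\<in>F. \<not> close x y \<and> \<not> close y x"
      using F(1) assms(3) by (auto simp: K_def)
    ultimately show ?thesis
      using F x by (intro exI[of _ "insert x F"]) (auto simp: K_def)
  qed simp
qed

section \<open>Packing in Frobenius distance\<close>

definition frob_dist2 :: "nat \<Rightarrow> mat \<Rightarrow> mat \<Rightarrow> real" where
  "frob_dist2 r A B = (\<Sum>i<r. \<Sum>j<r. (A (i, j) - B (i, j))\<^sup>2)"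

lemma frob_dist2_commute: "frob_dist2 r A B = frob_dist2 r B A"
  by (simp add: frob_dist2_def power2_commute)

lemma frob_dist2_cols_le:
  assumes "m \<le> r"
  shows "(\<Sum>a<m. \<Sum>k<r. (A (k, a) - B (k, a))\<^sup>2) \<le> frob_dist2 r A B"
  unfolding frob_dist2_def
  by (subst (2) sum.swap, rule sum_mono2) (use assms in \<open>auto intro: sum_nonneg\<close>)

definition scalar_mat :: "real \<Rightarrow> mat" where
  "scalar_mat c = (\<lambda>(i, j). if i = j then c else 0)"

lemma orthonormal_scalar_mat:
  assumes "c\<^sup>2 = 1"
  shows "orthonormal_cols r r (scalar_mat c)"
proof -
  have "(\<Sum>k<r. scalar_mat c (k, a) * scalar_mat c (k, b)) = (if a = b then 1 else 0)"
    if "a < r" for a b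
  proof -
    have "(\<Sum>k<r. scalar_mat c (k, a) * scalar_mat c (k, b))
        = (\<Sum>k<r. if k = a then (if a = b then 1 else 0) else 0)"
      using assms by (intro sum.cong) (auto simp: scalar_mat_def power2_eq_square)
    then show ?thesis using that by simp
  qed
  then show ?thesis by (simp add: orthonormal_cols_def)
qed

text \<open>For \<open>r < 32\<close> the two matrices \<open>I\<close> and \<open>-I\<close> suffice, the exponent being at most 1.\<close>

lemma orth_group_packing:
  assumes "1 \<le> r"
  shows "\<exists>F. finite F \<and> F \<subseteq> orth_group r
    \<and> (\<forall>A\<in>F. \<forall>B\<in>F. A \<noteq> B \<longrightarrow> real r / 48 \<le> frob_dist2 r A B)
    \<and> 2 powr (real r ^ 2 / 1024) \<le> card F"
proof (cases "r < 32")
  case True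
  let ?I = "scalar_mat 1" and ?N = "scalar_mat (-1)"
  have I: "?I \<in> orth_group r" "?N \<in> orth_group r"
    by (auto simp: orth_group_def intro: orthonormal_scalar_mat)
  have d: "frob_dist2 r ?I ?N = 4 * r"
  proof -
    have "(\<Sum>j<r. (?I (i, j) - ?N (i, j))\<^sup>2) = 4" if "i < r" for i
    proof -
      have "(\<Sum>j<r. (?I (i, j) - ?N (i, j))\<^sup>2) = (\<Sum>j<r. if i = j then 4 else 0)"
        by (intro sum.cong) (auto simp: scalar_mat_def)
      then show ?thesis using that by simp
    qed
    then show ?thesis by (simp add: frob_dist2_def)
  qed
  have "real r ^ 2 \<le> 32 ^ 2" using True by (intro power_mono) auto
  then have "2 powr (real r ^ 2 / 1024) \<le> 2 powr 1" by (intro powr_mono) auto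
  moreover have "?I \<noteq> ?N" by (auto simp: scalar_mat_def fun_eq_iff intro!: exI[of _ 0])
  ultimately show ?thesis
    using I d frob_dist2_commute[of r ?N ?I] by (intro exI[of _ "{?I, ?N}"]) auto
next
  case False
  define m d where "m = r div 2" and "d = r - m"
  have md: "m + d = r" "0 < d" "m \<le> r" using False by (auto simp: m_def d_def)
  define J where "J = {xs. set xs \<subseteq> Pow {..<d} \<and> length xs = m}"
  define Om where "Om = (\<lambda>xs. orth_completion r m (col_tree r d xs))"
  define close where "close = (\<lambda>xs ys. frob_dist2 r (Om xs) (Om ys) < real r / 48)"
  have finJ: "finite J" unfolding J_def by (rule finite_lists_length_eq) simp
  have cardJ: "card J = 2 ^ (d * m)"
    unfolding J_def by (subst card_lists_length_eq) (auto simp: card_Pow power_mult)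
  have Om: "Om xs \<in> orth_group r" "\<And>a k. a < m \<Longrightarrow> Om xs (k, a) = col_tree r d xs (k, a)"
    if "xs \<in> J" for xs
    using orth_completion[OF col_tree_orthonormal[of xs d r]] that md
    by (auto simp: J_def Om_def orth_group_def)
  have refl: "close xs xs" for xs
    using False by (simp add: close_def frob_dist2_def)
  have sym: "close ys xs" if "close xs ys" for xs ys
    using that by (simp add: close_def frob_dist2_commute)
  have "card {xs \<in> J. close ys xs} \<le> 2 powr (m + 7 * real d * m / 8)" if "ys \<in> J" for ys
  proof -
    have "2 * far_cols r d (Om ys) xs \<le> m" if "xs \<in> J" "close ys xs" for xs
    proof -
      have "far_cols r d (Om ys) xs / 8
          \<le> (\<Sum>a<m. \<Sum>k<r. (col_tree r d xs (k, a) - Om ys (k, a))\<^sup>2)"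
        using far_cols_le[of r d "Om ys" xs] that by (simp add: J_def)
      also have "\<dots> = (\<Sum>a<m. \<Sum>k<r. (Om xs (k, a) - Om ys (k, a))\<^sup>2)"
        by (simp add: Om(2)[OF that(1)])
      also have "\<dots> \<le> frob_dist2 r (Om xs) (Om ys)"
        by (rule frob_dist2_cols_le) (fact md)
      also have "\<dots> < real r / 48" using sym[OF that(2)] by (simp add: close_def)
      \<comment> \<open>As \<open>8 / 48 = 1 / 6\<close>, fewer than \<open>r / 6\<close> columns
        are far, and \<open>r / 6\<close> is at most half of \<open>m\<close>.\<close>
      finally have "6 * far_cols r d (Om ys) xs < r" by linarith
      then show ?thesis unfolding m_def using False by linarith
    qed
    then have "card {xs \<in> J. close ys xs}
        \<le> card {xs. set xs \<subseteq> Pow {..<d} \<and> length xs = m \<and> 2 * far_cols r d (Om ys) xs \<le> m}"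
      by (intro card_mono finite_subset[OF _ finJ]) (auto simp: J_def)
    also have "real \<dots> \<le> 2 powr (m + 7 * real d * m / 8)"
      using md by (intro card_few_far_cols) auto
    finally show ?thesis by simp
  qed
  from ex_separated_subset[OF finJ refl sym this] obtain F where
    F: "F \<subseteq> J" "\<forall>x\<in>F. \<forall>y\<in>F. x \<noteq> y \<longrightarrow> \<not> close x y"
       "card J \<le> 2 powr (m + 7 * real d * m / 8) * card F" by blast
  have "inj_on Om F"
  proof (rule inj_onI)
    fix x y assume "x \<in> F" "y \<in> F" "Om x = Om y"
    moreover from this have "close x y" using refl[of x] by (simp add: close_def)
    ultimately show "x = y" using F(2) by blast
  qed
  then have card: "card (Om ` F) = card F" by (rule card_image)
  have "2 powr (real d * m) = card J" by (simp add: cardJ flip: powr_realpow)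
  then have "2 powr (real d * m) / 2 powr (m + 7 * real d * m / 8) \<le> card F"
    using F(3) by (simp add: field_simps)
  then have 1: "2 powr (real d * m / 8 - m) \<le> card F"
    by (simp add: powr_diff[symmetric] algebra_simps)
  \<comment> \<open>For \<open>r >= 32\<close> one has
    \<open>d / 8 - 1 >= r / 16 - 1 >= r / 32\<close>; this explains the threshold of the case
    distinction.\<close>
  have "real r / 3 \<le> m" "real r / 2 \<le> d" "32 \<le> r"
    using False unfolding m_def d_def by linarith+
  then have "real r ^ 2 / 1024 \<le> (real r / 32) * (real r / 3)"
    by (simp add: power2_eq_square field_simps)
  also have "\<dots> \<le> (real d / 8 - 1) * m"
    using \<open>real r / 3 \<le> m\<close> \<open>real r / 2 \<le> d\<close> \<open>32 \<le> r\<close> by (intro mult_mono) auto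
  also have "\<dots> = real d * m / 8 - m" by (simp add: algebra_simps)
  finally have "2 powr (real r ^ 2 / 1024) \<le> card F"
    using 1 powr_mono[of "real r ^ 2 / 1024" "real d * m / 8 - m" 2] by linarith
  then show ?thesis
    using F finJ Om(1) card
    by (intro exI[of _ "Om ` F"]) (auto simp: close_def not_less intro: finite_subset)
qed

section \<open>Gaussian shifts\<close>

text \<open>Both measures agree on boxes, where the integral factorises. This and the next lemma
  turn a shift of the noise vector into a product density.\<close>

lemma PiM_density_eq_density_PiM:
  assumes "finite I" "\<And>i. prob_space (M i)"
    and f[measurable]: "\<And>i. f i \<in> borel_measurable (M i)"
    and "\<And>i. prob_space (density (M i) (f i))"
  shows "PiM I (\<lambda>i. density (M i) (f i)) = density (PiM I M) (\<lambda>x. \<Prod>i\<in>I. f i (x i))"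
proof -
  interpret M: product_prob_space M by (rule product_prob_spaceI) fact
  interpret D: product_prob_space "\<lambda>i. density (M i) (f i)" by (rule product_prob_spaceI) fact
  show ?thesis
  proof (rule D.PiM_eqI[symmetric])
    fix A assume A: "\<And>i. i \<in> I \<Longrightarrow> A i \<in> sets (density (M i) (f i))"
    then have A': "\<And>i. i \<in> I \<Longrightarrow> A i \<in> sets (M i)" by simp
    have "emeasure (density (PiM I M) (\<lambda>x. \<Prod>i\<in>I. f i (x i))) (Pi\<^sub>E I A)
        = (\<integral>\<^sup>+ x. (\<Prod>i\<in>I. f i (x i)) * indicator (Pi\<^sub>E I A) x \<partial>PiM I M)"
      by (rule emeasure_density) (use A' assms(1) in \<open>auto intro!: sets_PiM_I_finite\<close>)
    also have "\<dots> = (\<integral>\<^sup>+ x. (\<Prod>i\<in>I. f i (x i) * indicator (A i) (x i)) \<partial>PiM I M)"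
    proof (rule nn_integral_cong)
      fix x assume "x \<in> space (PiM I M)"
      then have "indicator (Pi\<^sub>E I A) x = (\<Prod>i\<in>I. indicator (A i) (x i) :: ennreal)"
        using assms(1) by (auto simp: space_PiM PiE_iff indicator_def prod_zero_iff)
      then show "(\<Prod>i\<in>I. f i (x i)) * indicator (Pi\<^sub>E I A) x
          = (\<Prod>i\<in>I. f i (x i) * indicator (A i) (x i))"
        by (simp add: prod.distrib)
    qed
    also have "\<dots> = (\<Prod>i\<in>I. \<integral>\<^sup>+ x. f i x * indicator (A i) x \<partial>M i)"
      using A' assms(1) by (intro M.product_nn_integral_prod) auto
    also have "\<dots> = (\<Prod>i\<in>I. emeasure (density (M i) (f i)) (A i))"
      using A' by (intro prod.cong refl emeasure_density[symmetric]) auto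
    finally show "emeasure (density (PiM I M) (\<lambda>x. \<Prod>i\<in>I. f i (x i))) (Pi\<^sub>E I A)
        = (\<Prod>i\<in>I. emeasure (density (M i) (f i)) (A i))" .
  qed (use assms(1) in \<open>auto intro!: sets_PiM_cong\<close>)
qed

lemma distr_PiM_componentwise:
  assumes "finite I" "\<And>i. prob_space (M i)" and f[measurable]: "\<And>i. f i \<in> measurable (M i) (M i)"
  shows "distr (PiM I M) (PiM I M) (\<lambda>x. \<lambda>i\<in>I. f i (x i)) = PiM I (\<lambda>i. distr (M i) (M i) (f i))"
proof -
  interpret M: product_prob_space M by (rule product_prob_spaceI) fact
  interpret D: product_prob_space "\<lambda>i. distr (M i) (M i) (f i)"
    by (intro product_prob_spaceI prob_space.prob_space_distr assms)
  show ?thesis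
  proof (rule D.PiM_eqI)
    fix A assume A: "\<And>i. i \<in> I \<Longrightarrow> A i \<in> sets (distr (M i) (M i) (f i))"
    then have A': "\<And>i. i \<in> I \<Longrightarrow> A i \<in> sets (M i)" by simp
    have eq: "(\<lambda>x. \<lambda>i\<in>I. f i (x i)) -` Pi\<^sub>E I A \<inter> space (PiM I M)
        = Pi\<^sub>E I (\<lambda>i. f i -` A i \<inter> space (M i))"
      by (auto simp: space_PiM PiE_iff extensional_def)
    have "emeasure (distr (PiM I M) (PiM I M) (\<lambda>x. \<lambda>i\<in>I. f i (x i))) (Pi\<^sub>E I A)
        = emeasure (PiM I M) (Pi\<^sub>E I (\<lambda>i. f i -` A i \<inter> space (M i)))"
      by (subst emeasure_distr) (use A' assms(1) eq in \<open>auto intro!: sets_PiM_I_finite\<close>)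
    also have "\<dots> = (\<Prod>i\<in>I. emeasure (M i) (f i -` A i \<inter> space (M i)))"
      using A' by (intro M.emeasure_PiM assms) auto
    also have "\<dots> = (\<Prod>i\<in>I. emeasure (distr (M i) (M i) (f i)) (A i))"
      using A' by (intro prod.cong refl emeasure_distr[symmetric]) auto
    finally show "emeasure (distr (PiM I M) (PiM I M) (\<lambda>x. \<lambda>i\<in>I. f i (x i))) (Pi\<^sub>E I A)
        = (\<Prod>i\<in>I. emeasure (distr (M i) (M i) (f i)) (A i))" .
  qed (use assms(1) in \<open>auto intro!: sets_PiM_cong\<close>)
qed

section \<open>The one-dimensional Gaussian likelihood ratio\<close>

lemma normal_density_tilt:
  assumes "0 < \<sigma>"
  shows "normal_density 0 \<sigma> x * exp ((2 * s * x - s\<^sup>2) / (2 * \<sigma>\<^sup>2)) = normal_density s \<sigma> x"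
proof -
  have "- x\<^sup>2 / (2 * \<sigma>\<^sup>2) + (2 * s * x - s\<^sup>2) / (2 * \<sigma>\<^sup>2) = - (x - s)\<^sup>2 / (2 * \<sigma>\<^sup>2)"
    using assms by (simp add: add_divide_distrib[symmetric] power2_eq_square algebra_simps)
  then have "exp (- x\<^sup>2 / (2 * \<sigma>\<^sup>2)) * exp ((2 * s * x - s\<^sup>2) / (2 * \<sigma>\<^sup>2))
      = exp (- (x - s)\<^sup>2 / (2 * \<sigma>\<^sup>2))"
    by (simp only: exp_add[symmetric])
  then show ?thesis
    by (simp only: normal_density_def diff_zero mult.assoc)
qed

text \<open>Cameron-Martin formula in dimension one: substitution moves the shift into the normal
  density, where completing the square exposes the weight.\<close>

lemma distr_normal_shift:
  assumes "0 < \<sigma>"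
  defines "N \<equiv> density lborel (normal_density 0 \<sigma>)"
  shows "distr N N (\<lambda>x. x + s) = density N (\<lambda>x. ennreal (exp ((2 * s * x - s\<^sup>2) / (2 * \<sigma>\<^sup>2))))"
proof (rule measure_eqI)
  show "sets (distr N N (\<lambda>x. x + s)) = sets (density N (\<lambda>x. ennreal (exp ((2 * s * x - s\<^sup>2) / (2 * \<sigma>\<^sup>2)))))"
    by simp
  fix A assume "A \<in> sets (distr N N (\<lambda>x. x + s))"
  then have A[measurable]: "A \<in> sets borel" by (simp add: N_def)
  have "emeasure (distr N N (\<lambda>x. x + s)) A = (\<integral>\<^sup>+ x. indicator A x \<partial>distr N N (\<lambda>x. x + s))"
    by (rule nn_integral_indicator[symmetric]) (simp add: N_def)
  also have "\<dots> = (\<integral>\<^sup>+ x. indicator A (x + s) \<partial>N)"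
    by (rule nn_integral_distr) (auto simp: N_def)
  also have "\<dots> = (\<integral>\<^sup>+ x. ennreal (normal_density 0 \<sigma> x) * indicator A (x + s) \<partial>lborel)"
    unfolding N_def by (subst nn_integral_density) auto
  also have "\<dots> = (\<integral>\<^sup>+ x. ennreal (normal_density 0 \<sigma> (- s + x)) * indicator A x \<partial>lborel)"
    by (subst nn_integral_real_affine[where c=1 and t="-s"]) auto
  also have "\<dots> = (\<integral>\<^sup>+ x. ennreal (normal_density 0 \<sigma> x) *
      (ennreal (exp ((2 * s * x - s\<^sup>2) / (2 * \<sigma>\<^sup>2))) * indicator A x) \<partial>lborel)"
  proof (rule nn_integral_cong)
    fix x :: real
    have "normal_density 0 \<sigma> (- s + x) = normal_density s \<sigma> x" by (simp add: normal_density_def)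
    also have "\<dots> = normal_density 0 \<sigma> x * exp ((2 * s * x - s\<^sup>2) / (2 * \<sigma>\<^sup>2))"
      by (rule normal_density_tilt[OF assms(1), symmetric])
    finally have "ennreal (normal_density 0 \<sigma> (- s + x))
        = ennreal (normal_density 0 \<sigma> x) * ennreal (exp ((2 * s * x - s\<^sup>2) / (2 * \<sigma>\<^sup>2)))"
      by (simp only: ennreal_mult normal_density_nonneg exp_ge_zero)
    then show "ennreal (normal_density 0 \<sigma> (- s + x)) * indicator A x
        = ennreal (normal_density 0 \<sigma> x) * (ennreal (exp ((2 * s * x - s\<^sup>2) / (2 * \<sigma>\<^sup>2))) * indicator A x)"
      by (simp only: mult.assoc)
  qed
  also have "\<dots> = (\<integral>\<^sup>+ x. ennreal (exp ((2 * s * x - s\<^sup>2) / (2 * \<sigma>\<^sup>2))) * indicator A x \<partial>N)"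
    unfolding N_def by (subst nn_integral_density) auto
  also have "\<dots> = emeasure (density N (\<lambda>x. ennreal (exp ((2 * s * x - s\<^sup>2) / (2 * \<sigma>\<^sup>2))))) A"
    by (subst emeasure_density) (auto simp: N_def)
  finally show "emeasure (distr N N (\<lambda>x. x + s)) A
    = emeasure (density N (\<lambda>x. ennreal (exp ((2 * s * x - s\<^sup>2) / (2 * \<sigma>\<^sup>2))))) A" .
qed

text \<open>Squaring the weight doubles the shift: up to the factor
  \<open>exp (s^2 / \<sigma>^2)\<close> the square is the weight for the shift \<open>2 * s\<close>,
  which integrates to 1.\<close>

lemma nn_integral_normal_likelihood_square:
  assumes "0 < \<sigma>"
  shows "(\<integral>\<^sup>+ x. ennreal ((exp ((2 * s * x - s\<^sup>2) / (2 * \<sigma>\<^sup>2)))\<^sup>2) \<partial>density lborel (normal_density 0 \<sigma>))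
    = ennreal (exp (s\<^sup>2 / \<sigma>\<^sup>2))"
proof -
  interpret P: prob_space "density lborel (normal_density (2 * s) \<sigma>)"
    using assms by (rule prob_space_normal_density)
  have *: "normal_density 0 \<sigma> x * (exp ((2 * s * x - s\<^sup>2) / (2 * \<sigma>\<^sup>2)))\<^sup>2
      = exp (s\<^sup>2 / \<sigma>\<^sup>2) * normal_density (2 * s) \<sigma> x" for x
  proof -
    have "(2 * s * x - s\<^sup>2) / (2 * \<sigma>\<^sup>2) + (2 * s * x - s\<^sup>2) / (2 * \<sigma>\<^sup>2)
        = s\<^sup>2 / \<sigma>\<^sup>2 + (2 * (2 * s) * x - (2 * s)\<^sup>2) / (2 * \<sigma>\<^sup>2)"
      using assms by (simp add: field_simps power2_eq_square)
    then have "(exp ((2 * s * x - s\<^sup>2) / (2 * \<sigma>\<^sup>2)))\<^sup>2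
        = exp (s\<^sup>2 / \<sigma>\<^sup>2) * exp ((2 * (2 * s) * x - (2 * s)\<^sup>2) / (2 * \<sigma>\<^sup>2))"
      by (simp add: power2_eq_square exp_add[symmetric])
    then show ?thesis
      unfolding normal_density_tilt[OF assms, of x "2 * s", symmetric] by (simp only: mult_ac)
  qed
  have "(\<integral>\<^sup>+ x. ennreal ((exp ((2 * s * x - s\<^sup>2) / (2 * \<sigma>\<^sup>2)))\<^sup>2) \<partial>density lborel (normal_density 0 \<sigma>))
     = (\<integral>\<^sup>+ x. ennreal (normal_density 0 \<sigma> x) * ennreal ((exp ((2 * s * x - s\<^sup>2) / (2 * \<sigma>\<^sup>2)))\<^sup>2) \<partial>lborel)"
    by (subst nn_integral_density) auto
  also have "\<dots> = (\<integral>\<^sup>+ x. ennreal (exp (s\<^sup>2 / \<sigma>\<^sup>2)) * ennreal (normal_density (2 * s) \<sigma> x) \<partial>lborel)"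
    by (simp only: ennreal_mult[symmetric] normal_density_nonneg zero_le_power2 exp_ge_zero *)
  also have "\<dots> = ennreal (exp (s\<^sup>2 / \<sigma>\<^sup>2)) * emeasure (density lborel (normal_density (2 * s) \<sigma>)) UNIV"
    by (subst nn_integral_cmult, simp) (subst emeasure_density, auto)
  also have "\<dots> = ennreal (exp (s\<^sup>2 / \<sigma>\<^sup>2))"
    using P.emeasure_space_1 by simp
  finally show ?thesis .
qed

text \<open>The likelihood ratio L of the shifted law satisfies \<open>L \<le> (1/t + t L\<^sup>2) / 2\<close>, and its second
  moment is the exponential of the squared shift.\<close>

lemma gaussian_shift_emeasure_le:
  fixes s :: "'i \<Rightarrow> real"
  assumes "finite I" "0 < \<sigma>" "0 < t"
  defines "Q \<equiv> PiM I (\<lambda>_. density lborel (normal_density 0 \<sigma>))"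
  assumes B[measurable]: "B \<in> sets Q"
  shows "emeasure Q ((\<lambda>w. \<lambda>i\<in>I. w i + s i) -` B \<inter> space Q)
    \<le> ennreal (1 / (2 * t)) * emeasure Q B + ennreal (t / 2 * exp ((\<Sum>i\<in>I. (s i)\<^sup>2) / \<sigma>\<^sup>2))"
proof -
  let ?N = "density lborel (normal_density 0 \<sigma>)"
  define l where "l = (\<lambda>i x. exp ((2 * s i * x - (s i)\<^sup>2) / (2 * \<sigma>\<^sup>2)))"
  have [measurable]: "l i \<in> borel_measurable borel" for i by (simp add: l_def)
  have N: "prob_space ?N" using assms(2) by (rule prob_space_normal_density)
  interpret M: product_prob_space "\<lambda>_::'i. ?N" by (rule product_prob_spaceI) fact
  have shift: "distr ?N ?N (\<lambda>x. x + s i) = density ?N (l i)" for i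
    using distr_normal_shift[OF assms(2), of "s i"] by (simp add: l_def)
  have pd: "prob_space (density ?N (l i))" for i
    unfolding shift[symmetric] by (rule prob_space.prob_space_distr[OF N]) simp
  have distr: "distr Q Q (\<lambda>w. \<lambda>i\<in>I. w i + s i) = density Q (\<lambda>w. \<Prod>i\<in>I. ennreal (l i (w i)))"
  proof -
    have "distr Q Q (\<lambda>w. \<lambda>i\<in>I. w i + s i) = PiM I (\<lambda>i. distr ?N ?N (\<lambda>x. x + s i))"
      unfolding Q_def by (rule distr_PiM_componentwise[OF assms(1) N]) simp
    also have "\<dots> = density Q (\<lambda>w. \<Prod>i\<in>I. ennreal (l i (w i)))"
      unfolding Q_def shift by (rule PiM_density_eq_density_PiM[OF assms(1) N _ pd]) simp
    finally show ?thesis .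
  qed
  define L where "L = (\<lambda>w. \<Prod>i\<in>I. l i (w i))"
  have Leq: "(\<Prod>i\<in>I. ennreal (l i (w i))) = ennreal (L w)" for w
    by (simp add: L_def prod_ennreal l_def)
  have Lmeas[measurable]: "L \<in> borel_measurable Q" unfolding L_def Q_def by measurable
  have meas: "(\<lambda>w. \<lambda>i\<in>I. w i + s i) \<in> measurable Q Q" unfolding Q_def by measurable
  have "emeasure Q ((\<lambda>w. \<lambda>i\<in>I. w i + s i) -` B \<inter> space Q)
      = emeasure (distr Q Q (\<lambda>w. \<lambda>i\<in>I. w i + s i)) B"
    using meas B by (simp add: emeasure_distr)
  also have "\<dots> = (\<integral>\<^sup>+ w. ennreal (L w) * indicator B w \<partial>Q)"
    unfolding distr Leq using B Lmeas by (subst emeasure_density) auto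
  also have "\<dots> \<le> (\<integral>\<^sup>+ w. ennreal (1 / (2 * t)) * indicator B w + ennreal (t / 2) * ennreal ((L w)\<^sup>2) \<partial>Q)"
  proof (rule nn_integral_mono)
    fix w
    have "0 \<le> (1 - t * L w)\<^sup>2" by simp
    then have "2 * (t * L w) \<le> 1 + (t * L w)\<^sup>2" by (simp add: power2_diff)
    then have "L w \<le> 1 / (2 * t) + t / 2 * (L w)\<^sup>2"
      using \<open>0 < t\<close> by (simp add: field_simps power2_eq_square)
    then have "ennreal (L w) \<le> ennreal (1 / (2 * t)) + ennreal (t / 2) * ennreal ((L w)\<^sup>2)"
      using \<open>0 < t\<close> by (simp add: ennreal_plus[symmetric] ennreal_mult[symmetric] del: ennreal_plus)
    then show "ennreal (L w) * indicator B w
        \<le> ennreal (1 / (2 * t)) * indicator B w + ennreal (t / 2) * ennreal ((L w)\<^sup>2)"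
      by (auto simp: indicator_def)
  qed
  also have "\<dots> = ennreal (1 / (2 * t)) * emeasure Q B + ennreal (t / 2) * (\<integral>\<^sup>+ w. ennreal ((L w)\<^sup>2) \<partial>Q)"
    by (subst nn_integral_add) (auto simp: nn_integral_cmult)
  also have "(\<integral>\<^sup>+ w. ennreal ((L w)\<^sup>2) \<partial>Q) = (\<integral>\<^sup>+ w. (\<Prod>i\<in>I. ennreal ((l i (w i))\<^sup>2)) \<partial>Q)"
    by (simp add: L_def prod_ennreal prod_power_distrib)
  also have "\<dots> = (\<Prod>i\<in>I. \<integral>\<^sup>+ x. ennreal ((l i x)\<^sup>2) \<partial>?N)"
    unfolding Q_def by (intro M.product_nn_integral_prod assms(1)) simp
  also have "\<dots> = (\<Prod>i\<in>I. ennreal (exp ((s i)\<^sup>2 / \<sigma>\<^sup>2)))"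
    unfolding l_def by (simp only: nn_integral_normal_likelihood_square[OF assms(2)])
  also have "\<dots> = ennreal (exp ((\<Sum>i\<in>I. (s i)\<^sup>2) / \<sigma>\<^sup>2))"
    by (simp add: prod_ennreal exp_sum[OF assms(1)] sum_divide_distrib)
  also have "ennreal (t / 2) * \<dots> = ennreal (t / 2 * exp ((\<Sum>i\<in>I. (s i)\<^sup>2) / \<sigma>\<^sup>2))"
    using \<open>0 < t\<close> by (intro ennreal_mult[symmetric]) auto
  finally show ?thesis .
qed

section \<open>Block hypotheses\<close>

text \<open>Block 0 is the identity and serves as a reference frame for alignment. The remaining
  rows are zero padding, so that \<open>b\<close> can be tuned to the signal strength.\<close>

definition block_mat :: "nat \<Rightarrow> nat \<Rightarrow> (nat \<Rightarrow> mat) \<Rightarrow> mat" where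
  "block_mat r b \<Psi> = (\<lambda>(k, j). if k < Suc b * r
     then (if k div r = 0 then scalar_mat 1 else \<Psi> (k div r)) (k mod r, j) / sqrt (Suc b) else 0)"

lemma block_mat_entry:
  assumes "\<beta> \<le> b" "i < r"
  shows "block_mat r b \<Psi> (\<beta> * r + i, j)
    = (if \<beta> = 0 then scalar_mat 1 else \<Psi> \<beta>) (i, j) / sqrt (Suc b)"
proof -
  have "\<beta> * r + i < Suc \<beta> * r" using assms by simp
  also have "\<dots> \<le> Suc b * r" using assms by (intro mult_right_mono) auto
  finally show ?thesis using assms by (simp add: block_mat_def)
qed

lemma block_mat_row_cases:
  assumes "k < Suc b * r"
  obtains \<beta> i where "\<beta> \<le> b" "i < r" "k = \<beta> * r + i"
proof
  have "0 < r" using assms by (cases r) auto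
  then show "k mod r < r" by simp
  show "k = (k div r) * r + k mod r" by simp
  show "k div r \<le> b" using assms by (metis less_mult_imp_div_less less_Suc_eq_le)
qed

lemma sum_blocks:
  fixes f :: "nat \<Rightarrow> real"
  assumes "Suc b * r \<le> n" "\<And>k. Suc b * r \<le> k \<Longrightarrow> f k = 0"
  shows "(\<Sum>k<n. f k) = (\<Sum>\<beta>\<le>b. \<Sum>i<r. f (\<beta> * r + i))"
proof -
  have "(\<Sum>k<n. f k) = (\<Sum>k<Suc b * r. f k)"
    using assms by (intro sum.mono_neutral_right) auto
  also have "\<dots> = (\<Sum>\<beta><Suc b. sum f {\<beta> * r..<\<beta> * r + r})"
    by (simp only: sum.nat_group)
  also have "\<dots> = (\<Sum>\<beta>\<le>b. \<Sum>i<r. f (\<beta> * r + i))"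
    by (simp only: lessThan_Suc_atMost sum.atLeastLessThan_shift_0 comp_def add_diff_cancel_left'
        atLeast0LessThan)
  finally show ?thesis .
qed

lemma orthonormal_block_mat:
  assumes "Suc b * r \<le> n" and \<Psi>: "\<And>\<beta>. \<beta> \<in> {1..b} \<Longrightarrow> \<Psi> \<beta> \<in> orth_group r"
  shows "orthonormal_cols n r (block_mat r b \<Psi>)"
  unfolding orthonormal_cols_def
proof (intro allI impI)
  fix a c assume ac: "a < r" "c < r"
  have blk: "orthonormal_cols r r (if \<beta> = 0 then scalar_mat 1 else \<Psi> \<beta>)" if "\<beta> \<le> b" for \<beta>
    using \<Psi>[of \<beta>] that by (auto simp: orth_group_def intro: orthonormal_scalar_mat)
  have "(\<Sum>k<n. block_mat r b \<Psi> (k, a) * block_mat r b \<Psi> (k, c))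
      = (\<Sum>\<beta>\<le>b. \<Sum>i<r. block_mat r b \<Psi> (\<beta> * r + i, a) * block_mat r b \<Psi> (\<beta> * r + i, c))"
    by (rule sum_blocks[OF assms(1)]) (simp add: block_mat_def)
  also have "\<dots> = (\<Sum>\<beta>\<le>b. (\<Sum>i<r. (if \<beta> = 0 then scalar_mat 1 else \<Psi> \<beta>) (i, a)
      * (if \<beta> = 0 then scalar_mat 1 else \<Psi> \<beta>) (i, c)) / real (Suc b))"
    unfolding sum_divide_distrib
    by (intro sum.cong refl) (simp only: block_mat_entry atMost_iff lessThan_iff times_divide_times_eq
        real_sqrt_mult_self abs_of_nat)
  also have "\<dots> = (\<Sum>\<beta>\<le>b. (if a = c then 1 else 0) / real (Suc b))"
    by (intro sum.cong refl) (simp only: orthonormal_colsD[OF blk ac] atMost_iff)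
  also have "\<dots> = (if a = c then 1 else 0)" by simp
  finally show "(\<Sum>k<n. block_mat r b \<Psi> (k, a) * block_mat r b \<Psi> (k, c)) = (if a = c then 1 else 0)" .
qed

text \<open>Rows of a square orthogonal matrix have norm 1, so all nonzero rows share one norm and
  incoherence becomes a condition on \<open>b\<close>.\<close>

lemma block_mat_in_K_set:
  assumes "1 \<le> r" "Suc b * r \<le> n" and \<Psi>: "\<And>\<beta>. \<beta> \<in> {1..b} \<Longrightarrow> \<Psi> \<beta> \<in> orth_group r"
    and \<mu>: "1 / real (Suc b) \<le> r * \<mu> / n"
  shows "block_mat r b \<Psi> \<in> K_set n r \<mu>"
proof -
  have "0 < n" using assms(1,2) by (cases n) auto
  have "sqrt (\<Sum>j<r. (block_mat r b \<Psi> (k, j))\<^sup>2) \<le> sqrt (r * \<mu> / n)" if "k < n" for k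
  proof (rule real_sqrt_le_mono, cases "k < Suc b * r")
    case True
    then obtain \<beta> i where k: "\<beta> \<le> b" "i < r" "k = \<beta> * r + i" by (rule block_mat_row_cases)
    let ?A = "if \<beta> = 0 then scalar_mat 1 else \<Psi> \<beta>"
    have blk: "orthonormal_cols r r ?A"
      using \<Psi>[of \<beta>] k by (auto simp: orth_group_def intro: orthonormal_scalar_mat)
    have "(\<Sum>j<r. (block_mat r b \<Psi> (k, j))\<^sup>2) = (\<Sum>j<r. ?A (i, j) * ?A (i, j)) / real (Suc b)"
      unfolding k(3) block_mat_entry[OF k(1,2)] sum_divide_distrib
      by (simp only: power2_eq_square times_divide_times_eq real_sqrt_mult_self abs_of_nat)
    also have "\<dots> = 1 / real (Suc b)"
      by (simp only: orthonormal_rows_of_square[OF blk k(2) k(2)] refl if_True)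
    finally show "(\<Sum>j<r. (block_mat r b \<Psi> (k, j))\<^sup>2) \<le> r * \<mu> / n" using \<mu> by simp
  next
    case False
    \<comment> \<open>The sign of \<open>r * \<mu> / n\<close>, which settles the zero rows, is read
      off from the incoherence hypothesis.\<close>
    have "0 \<le> 1 / real (Suc b)" by simp
    then have "0 \<le> r * \<mu> / n" using \<mu> by linarith
    then show "(\<Sum>j<r. (block_mat r b \<Psi> (k, j))\<^sup>2) \<le> r * \<mu> / n"
      using False by (simp add: block_mat_def)
  qed
  then have "norm_2inf n r (block_mat r b \<Psi>) \<le> sqrt (r * \<mu> / n)"
    using \<open>0 < n\<close> unfolding norm_2inf_def by (subst Max_le_iff) auto
  then show ?thesis
    using orthonormal_block_mat[OF assms(2) \<Psi>] by (simp add: K_set_def)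
qed

text \<open>An open stand-in for the set where \<open>d_2inf n r V U < \<eta>\<close>; openness gives measurability, which is
  not evident for an infimum over the uncountable orthogonal group.\<close>

definition near_set :: "nat \<Rightarrow> nat \<Rightarrow> real \<Rightarrow> mat \<Rightarrow> mat set" where
  "near_set n r \<eta> U = {V. \<exists>G\<in>orth_group r. \<forall>i<n.
     (\<Sum>j<r. (U (i, j) - (\<Sum>k<r. V (i, k) * G (k, j)))\<^sup>2) < \<eta>\<^sup>2}"

lemma d_2inf_ge:
  assumes "0 < n" "0 < \<eta>" "V \<notin> near_set n r \<eta> U"
  shows "\<eta> \<le> d_2inf n r V U"
proof (rule ccontr)
  assume "\<not> \<eta> \<le> d_2inf n r V U"
  then have "Inf ((\<lambda>G. norm_2inf n r (\<lambda>ij. U ij - mat_mult r V G ij)) ` orth_group r) < \<eta>"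
    by (simp add: d_2inf_def)
  \<comment> \<open>Nonemptiness of the set of alignments, required to extract a witness from an
    infimum of reals.\<close>
  moreover have "scalar_mat 1 \<in> orth_group r"
    by (simp add: orth_group_def orthonormal_scalar_mat)
  ultimately obtain G where G: "G \<in> orth_group r"
    "norm_2inf n r (\<lambda>ij. U ij - mat_mult r V G ij) < \<eta>"
    using cInf_lessD[of "(\<lambda>G. norm_2inf n r (\<lambda>ij. U ij - mat_mult r V G ij)) ` orth_group r" \<eta>]
    by blast
  have sq: "x < \<eta>\<^sup>2" if "sqrt x < \<eta>" for x
  proof -
    have "sqrt x < sqrt (\<eta>\<^sup>2)" using that assms(2) by simp
    then show ?thesis by (simp only: real_sqrt_less_iff)
  qed
  from G(2) have "\<forall>i<n. sqrt (\<Sum>j<r. (U (i, j) - (\<Sum>k<r. V (i, k) * G (k, j)))\<^sup>2) < \<eta>"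
    using assms(1) unfolding norm_2inf_def by (subst (asm) Max_less_iff) (auto simp: mat_mult_def)
  then have "\<forall>i<n. (\<Sum>j<r. (U (i, j) - (\<Sum>k<r. V (i, k) * G (k, j)))\<^sup>2) < \<eta>\<^sup>2"
    using sq by blast
  then show False using G(1) assms(3) unfolding near_set_def by blast
qed

text \<open>For a fixed rotation this is a finite intersection of open conditions, and the
  uncountable union over rotations stays open.\<close>

lemma open_near_set: "open (near_set n r \<eta> U)"
proof -
  have eq: "near_set n r \<eta> U = (\<Union>G\<in>orth_group r. \<Inter>i\<in>{..<n}.
      {V. (\<Sum>j<r. (U (i, j) - (\<Sum>k<r. V (i, k) * G (k, j)))\<^sup>2) < \<eta>\<^sup>2})"
    by (auto simp: near_set_def)
  show ?thesis
    unfolding eq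
    by (intro open_UN ballI open_INT finite_lessThan open_Collect_less continuous_intros
        continuous_on_product_coordinates)
qed

text \<open>The set is Borel in the space of all functions, a countable product, and the inclusion
  of the estimator space is measurable coordinate by coordinate.\<close>

lemma near_set_measurable:
  "near_set n r \<eta> U \<inter> space (est_space n r) \<in> sets (est_space n r)"
proof -
  let ?I = "{..<n} \<times> {..<r}"
  have "(\<lambda>V. V) \<in> measurable (est_space n r) (PiM UNIV (\<lambda>_. borel))"
  proof (rule measurable_PiM_single')
    fix p :: "nat \<times> nat"
    show "(\<lambda>V. V p) \<in> measurable (est_space n r) borel"
    proof (cases "p \<in> ?I")
      case True
      then show ?thesis unfolding est_space_def by (rule measurable_component_singleton)
    next
      case False
      \<comment> \<open>Outside the \<open>n\<close> by \<open>r\<close> rectangle every element of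
        the \<open>PiM\<close> space has the constant value \<open>undefined\<close>.\<close>
      then have "V p = undefined" if "V \<in> space (est_space n r)" for V
        using that by (cases p) (auto simp: est_space_def space_PiM PiE_iff extensional_def)
      then show ?thesis by (subst measurable_cong[where g="\<lambda>_. undefined"]) auto
    qed
  qed auto
  then have "(\<lambda>V. V) \<in> measurable (est_space n r) (borel :: mat measure)"
    by (simp only: measurable_cong_sets[OF refl sets_PiM_equal_borel])
  from measurable_sets[OF this borel_open[OF open_near_set]] show ?thesis by simp
qed

text \<open>The row vector \<open>u\<close> acted on by \<open>G\<^sup>T H\<close>.\<close>

definition realign :: "nat \<Rightarrow> mat \<Rightarrow> mat \<Rightarrow> (nat \<Rightarrow> real) \<Rightarrow> nat \<Rightarrow> real" where
  "realign r G H u c = (\<Sum>l<r. (\<Sum>a<r. G (l, a) * u a) * H (l, c))"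

lemma realign_norm:
  assumes "orthonormal_cols r r G" "orthonormal_cols r r H"
  shows "(\<Sum>c<r. (realign r G H u c)\<^sup>2) = (\<Sum>a<r. (u a)\<^sup>2)"
  using orthonormal_cols_isometry[OF orthonormal_transpose_mat[OF assms(2)], of "\<lambda>l. \<Sum>a<r. G (l, a) * u a"]
    orthonormal_cols_isometry[OF assms(1), of u]
  by (simp add: realign_def transpose_mat_def mult.commute)

lemma realign_diff:
  "realign r G H (\<lambda>a. u a - v a) c = realign r G H u c - realign r G H v c"
  by (simp add: realign_def right_diff_distrib left_diff_distrib sum_subtractf)

lemma realign_divide:
  "realign r G H (\<lambda>a. u a / s) c = realign r G H u c / s"
  by (simp add: realign_def flip: sum_divide_distrib)

lemma realign_row:
  assumes G: "orthonormal_cols r r G"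
  shows "realign r G H (\<lambda>a. \<Sum>k<r. x k * G (k, a)) c = (\<Sum>k<r. x k * H (k, c))"
proof -
  have "(\<Sum>a<r. G (l, a) * (\<Sum>k<r. x k * G (k, a))) = x l" if "l < r" for l
  proof -
    have "(\<Sum>a<r. G (l, a) * (\<Sum>k<r. x k * G (k, a))) = (\<Sum>k<r. x k * (\<Sum>a<r. G (l, a) * G (k, a)))"
      unfolding sum_distrib_left by (subst sum.swap) (simp add: mult_ac)
    also have "\<dots> = (\<Sum>k<r. if k = l then x k else 0)"
      using that by (intro sum.cong) (auto simp: orthonormal_rows_of_square[OF G])
    also have "\<dots> = x l" using that by simp
    finally show ?thesis .
  qed
  then show ?thesis by (simp add: realign_def)
qed

text \<open>The unknown row \<open>x\<close> cancels: realignment carries \<open>x G\<close> exactly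
  to \<open>x H\<close> and preserves norms, so only the two approximation errors remain.\<close>

lemma realign_close:
  assumes G: "orthonormal_cols r r G" and H: "orthonormal_cols r r H"
    and u: "(\<Sum>a<r. (u a - (\<Sum>k<r. x k * G (k, a)))\<^sup>2) < \<epsilon>"
    and v: "(\<Sum>a<r. (v a - (\<Sum>k<r. x k * H (k, a)))\<^sup>2) < \<epsilon>"
  shows "(\<Sum>c<r. (realign r G H u c - v c)\<^sup>2) < 4 * \<epsilon>"
proof -
  let ?p = "\<lambda>a. u a - (\<Sum>k<r. x k * G (k, a))" and ?q = "\<lambda>a. v a - (\<Sum>k<r. x k * H (k, a))"
  have "realign r G H u c - v c = realign r G H ?p c - ?q c" for c
    by (simp add: realign_diff realign_row[OF G])
  then have "(\<Sum>c<r. (realign r G H u c - v c)\<^sup>2)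
      \<le> 2 * (\<Sum>c<r. (realign r G H ?p c)\<^sup>2) + 2 * (\<Sum>c<r. (?q c)\<^sup>2)"
    by (simp only: sum_diff_square_le)
  also have "\<dots> < 4 * \<epsilon>" using u v by (simp add: realign_norm[OF G H])
  finally show ?thesis .
qed

text \<open>The identity block of both matrices forces the realigning rotation \<open>G\<^sup>T H\<close> to be close to the
  identity; this removes the rotation from the comparison of the remaining blocks.\<close>

lemma block_mat_separated:
  assumes "1 \<le> r" "Suc b * r \<le> n" "\<beta> \<in> {1..b}" and A: "\<Psi> \<beta> \<in> orth_group r"
    and V: "V \<in> near_set n r (1 / (32 * sqrt (Suc b))) (block_mat r b \<Psi>)"
           "V \<in> near_set n r (1 / (32 * sqrt (Suc b))) (block_mat r b \<Phi>)"
  shows "frob_dist2 r (\<Psi> \<beta>) (\<Phi> \<beta>) < r / 48"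
proof -
  define s where "s = sqrt (Suc b)"
  have s: "0 < s" by (simp add: s_def)
  obtain G H where G: "orthonormal_cols r r G" and H: "orthonormal_cols r r H"
    and dG: "\<And>i. i < n \<Longrightarrow>
      (\<Sum>j<r. (block_mat r b \<Psi> (i, j) - (\<Sum>k<r. V (i, k) * G (k, j)))\<^sup>2) < (1 / (32 * s))\<^sup>2"
    and dH: "\<And>i. i < n \<Longrightarrow>
      (\<Sum>j<r. (block_mat r b \<Phi> (i, j) - (\<Sum>k<r. V (i, k) * H (k, j)))\<^sup>2) < (1 / (32 * s))\<^sup>2"
    using V unfolding near_set_def orth_group_def s_def by blast
  \<comment> \<open>Used for \<open>\<gamma> = 0\<close> and for \<open>\<gamma> = \<beta>\<close>;
    the constant is \<open>4 / 32^2\<close>.\<close>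
  have row: "(\<Sum>c<r. (realign r G H (\<lambda>j. P (i, j)) c - P' (i, c))\<^sup>2) < 1 / 256"
    if "\<gamma> \<le> b" "i < r" "P = (if \<gamma> = 0 then scalar_mat 1 else \<Psi> \<gamma>)"
       "P' = (if \<gamma> = 0 then scalar_mat 1 else \<Phi> \<gamma>)" for \<gamma> i P P'
  proof -
    have "\<gamma> * r + i < Suc \<gamma> * r" using that by simp
    also have "\<dots> \<le> Suc b * r" using that by (intro mult_right_mono) auto
    finally have k: "\<gamma> * r + i < n" using assms(2) by simp
    have "(\<Sum>c<r. (realign r G H (\<lambda>j. block_mat r b \<Psi> (\<gamma> * r + i, j)) c
        - block_mat r b \<Phi> (\<gamma> * r + i, c))\<^sup>2) < 4 * (1 / (32 * s))\<^sup>2"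
      by (rule realign_close[OF G H dG[OF k] dH[OF k]])
    also have "(\<Sum>c<r. (realign r G H (\<lambda>j. block_mat r b \<Psi> (\<gamma> * r + i, j)) c
        - block_mat r b \<Phi> (\<gamma> * r + i, c))\<^sup>2)
      = (\<Sum>c<r. (realign r G H (\<lambda>j. P (i, j)) c - P' (i, c))\<^sup>2) / s\<^sup>2"
      unfolding block_mat_entry[OF that(1,2)] that(3,4)[symmetric] s_def[symmetric] realign_divide
        diff_divide_distrib[symmetric] power_divide sum_divide_distrib ..
    finally show ?thesis using s by (simp add: field_simps power2_eq_square)
  qed
  let ?P = "\<Psi> \<beta>" and ?Q = "\<Phi> \<beta>"
  have A': "orthonormal_cols r r ?P" using A by (simp add: orth_group_def)
  have 1: "(\<Sum>i<r. \<Sum>c<r. (realign r G H (\<lambda>j. ?P (i, j)) c - ?Q (i, c))\<^sup>2) \<le> (\<Sum>i<r. 1 / 256)"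
    using assms(3) by (intro sum_mono) (rule less_imp_le, rule row[of \<beta>], auto)
  \<comment> \<open>With \<open>R = G^T H\<close> this reads \<open>P R - P = P (R - I)\<close>.
    Since \<open>P\<close> is an isometry on columns, the deviation on block \<open>\<beta>\<close>
    has the size of that on the identity block.\<close>
  have lin: "realign r G H (\<lambda>j. ?P (i, j)) c - ?P (i, c)
      = (\<Sum>k<r. ?P (i, k) * (realign r G H (\<lambda>j. scalar_mat 1 (k, j)) c - scalar_mat 1 (k, c)))"
    if "i < r" "c < r" for i c
  proof -
    have u: "realign r G H (\<lambda>j. scalar_mat 1 (k, j)) c = (\<Sum>l<r. G (l, k) * H (l, c))" if "k < r" for k
    proof -
      have "(\<Sum>a<r. G (l, a) * scalar_mat 1 (k, a)) = (\<Sum>a<r. if k = a then G (l, a) else 0)" for l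
        by (intro sum.cong) (auto simp: scalar_mat_def)
      then show ?thesis using that by (simp add: realign_def)
    qed
    have "(\<Sum>k<r. ?P (i, k) * scalar_mat 1 (k, c)) = (\<Sum>k<r. if k = c then ?P (i, k) else 0)"
      by (intro sum.cong) (auto simp: scalar_mat_def)
    then have "(\<Sum>k<r. ?P (i, k) * scalar_mat 1 (k, c)) = ?P (i, c)" using that by simp
    moreover have "(\<Sum>k<r. ?P (i, k) * realign r G H (\<lambda>j. scalar_mat 1 (k, j)) c)
        = realign r G H (\<lambda>j. ?P (i, j)) c"
      unfolding realign_def sum_distrib_right[symmetric]
      by (subst sum.cong[OF refl, where h="\<lambda>k. ?P (i, k) * (\<Sum>l<r. G (l, k) * H (l, c))"])
         (use u[unfolded realign_def] in \<open>auto simp: sum_distrib_left sum_distrib_right mult_ac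
           intro: sum.swap[THEN trans]\<close>)
    ultimately show ?thesis by (simp add: right_diff_distrib sum_subtractf)
  qed
  have "(\<Sum>i<r. \<Sum>c<r. (realign r G H (\<lambda>j. ?P (i, j)) c - ?P (i, c))\<^sup>2)
      = (\<Sum>c<r. \<Sum>i<r. (\<Sum>k<r. ?P (i, k)
          * (realign r G H (\<lambda>j. scalar_mat 1 (k, j)) c - scalar_mat 1 (k, c)))\<^sup>2)"
    by (subst sum.swap) (intro sum.cong refl, simp only: lin lessThan_iff)
  also have "\<dots> = (\<Sum>c<r. \<Sum>k<r. (realign r G H (\<lambda>j. scalar_mat 1 (k, j)) c - scalar_mat 1 (k, c))\<^sup>2)"
    by (simp only: orthonormal_cols_isometry[OF A'])
  also have "\<dots> = (\<Sum>k<r. \<Sum>c<r. (realign r G H (\<lambda>j. scalar_mat 1 (k, j)) c - scalar_mat 1 (k, c))\<^sup>2)"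
    by (rule sum.swap)
  also have "\<dots> \<le> (\<Sum>k<r. 1 / 256)"
    by (intro sum_mono) (rule less_imp_le, rule row[of 0], auto)
  finally have 2: "(\<Sum>i<r. \<Sum>c<r. (realign r G H (\<lambda>j. ?P (i, j)) c - ?P (i, c))\<^sup>2) \<le> (\<Sum>k<r. 1 / 256)" .
  have "frob_dist2 r ?P ?Q = (\<Sum>i<r. \<Sum>c<r. ((realign r G H (\<lambda>j. ?P (i, j)) c - ?Q (i, c))
      - (realign r G H (\<lambda>j. ?P (i, j)) c - ?P (i, c)))\<^sup>2)"
    by (simp add: frob_dist2_def)
  also have "\<dots> \<le> (\<Sum>i<r. 2 * (\<Sum>c<r. (realign r G H (\<lambda>j. ?P (i, j)) c - ?Q (i, c))\<^sup>2)
      + 2 * (\<Sum>c<r. (realign r G H (\<lambda>j. ?P (i, j)) c - ?P (i, c))\<^sup>2))"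
    by (intro sum_mono sum_diff_square_le)
  also have "\<dots> \<le> real r / 64"
    using 1 2 by (simp add: sum.distrib sum_distrib_left[symmetric])
  also have "\<dots> < r / 48" using assms(1) by simp
  finally show ?thesis .
qed

section \<open>Reduction to testing\<close>

text \<open>The upper triangle carries the independent entries; the whole matrix has squared
  Frobenius norm \<open>lam^2 * r\<close>, as \<open>U U^T\<close> is a projection of rank
  \<open>r\<close>.\<close>

lemma sum_signal_square_le:
  assumes U: "orthonormal_cols n r U"
  shows "(\<Sum>p\<in>{(i, j). i \<le> j \<and> j < n}. (signal r lam U p)\<^sup>2) \<le> lam\<^sup>2 * r"
proof -
  have "(\<Sum>p\<in>{(i, j). i \<le> j \<and> j < n}. (signal r lam U p)\<^sup>2)
      \<le> (\<Sum>p\<in>{..<n} \<times> {..<n}. (signal r lam U p)\<^sup>2)"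
    by (rule sum_mono2) auto
  also have "\<dots> = (\<Sum>j<n. \<Sum>i<n. (signal r lam U (j, i))\<^sup>2)"
    by (simp add: sum.cartesian_product)
  also have "\<dots> = (\<Sum>j<n. lam\<^sup>2 * (\<Sum>i<n. (\<Sum>k<r. U (i, k) * U (j, k))\<^sup>2))"
    by (simp add: signal_def power_mult_distrib mult.commute flip: sum_distrib_left)
  also have "\<dots> = lam\<^sup>2 * r"
    by (simp add: orthonormal_cols_isometry[OF U] sum_distrib_left[symmetric]
        sum_squares_orthonormal_cols[OF U])
  finally show ?thesis .
qed

lemma finite_upper_indices: "finite {(i, j). i \<le> j \<and> j < (n :: nat)}"
  by (rule finite_subset[of _ "{..<n} \<times> {..<n}"]) auto

lemma measurable_observe:
  "observe n M \<in> measurable (noise_space n \<sigma>) (obs_space n)"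
  unfolding observe_def obs_space_def
proof (rule measurable_restrict)
  fix p assume p: "p \<in> {..<n} \<times> {..<n}"
  obtain i j where ij: "p = (i, j)" by (cases p)
  have "(\<lambda>w. w (min i j, max i j)) \<in> measurable (noise_space n \<sigma>) (density lborel (normal_density 0 \<sigma>))"
    unfolding noise_space_def using p ij by (intro measurable_component_singleton) auto
  then have [measurable]: "(\<lambda>w. w (min i j, max i j)) \<in> borel_measurable (noise_space n \<sigma>)"
    by simp
  show "(\<lambda>w. case p of (i, j) \<Rightarrow> M (i, j) + w (min i j, max i j)) \<in> borel_measurable (noise_space n \<sigma>)"
    unfolding ij by simp
qed

text \<open>The signal is symmetric, so it can be added to the upper triangle before mirroring.
  Every hypothesis is thus a shift of one noise vector followed by one common map.\<close>

lemma observe_signal: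
  "observe n (signal r lam U) w
    = observe n (\<lambda>_. 0) (\<lambda>p\<in>{(i, j). i \<le> j \<and> j < n}. w p + signal r lam U p)"
proof -
  have "signal r lam U (i, j) = signal r lam U (min i j, max i j)" for i j
    by (cases "i \<le> j") (simp_all add: signal_def mult.commute)
  then show ?thesis by (auto simp: observe_def fun_eq_iff)
qed

lemma prob_space_noise: "0 < \<sigma> \<Longrightarrow> prob_space (noise_space n \<sigma>)"
  unfolding noise_space_def by (intro prob_space_PiM prob_space_normal_density)

text \<open>Pure noise is the common reference law. Disjoint events have reference probabilities
  adding up to at most 1, and the shift inequality transfers this to an average success probability
  of at most 1/2.\<close>

lemma ex_hypothesis_missed:
  assumes "0 < \<sigma>" and J: "finite J" "J \<noteq> {}"
    and Uhat[measurable]: "Uhat \<in> measurable (obs_space n) (est_space n r)"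
    and A: "\<And>j. j \<in> J \<Longrightarrow> A j \<in> sets (est_space n r)" and disj: "disjoint_family_on A J"
    and U: "\<And>j. j \<in> J \<Longrightarrow> orthonormal_cols n r (U j)"
    and card: "4 * exp (lam\<^sup>2 * r / \<sigma>\<^sup>2) \<le> card J"
  shows "\<exists>j\<in>J. measure (noise_space n \<sigma>)
      {w \<in> space (noise_space n \<sigma>). Uhat (observe n (signal r lam (U j)) w) \<in> A j} \<le> 1 / 2"
proof (rule ccontr)
  let ?Q = "noise_space n \<sigma>" and ?S = "{(i, j). i \<le> j \<and> j < n}"
  let ?P = "\<lambda>j. {w \<in> space ?Q. Uhat (observe n (signal r lam (U j)) w) \<in> A j}"
  let ?B = "\<lambda>j. {w \<in> space ?Q. Uhat (observe n (\<lambda>_. 0) w) \<in> A j}"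
  assume "\<not> ?thesis"
  then have large: "\<And>j. j \<in> J \<Longrightarrow> 1 / 2 < measure ?Q (?P j)" by (auto simp: not_le)
  interpret Q: prob_space ?Q using assms(1) by (rule prob_space_noise)
  define M where "M = real (card J)"
  have M: "0 < M" using J by (simp add: M_def card_gt_0_iff)
  have B: "?B j \<in> sets ?Q" if "j \<in> J" for j
  proof -
    have "(\<lambda>w. Uhat (observe n (\<lambda>_. 0) w)) \<in> measurable ?Q (est_space n r)"
      using measurable_compose[OF measurable_observe Uhat] .
    from measurable_sets[OF this A[OF that]] show ?thesis by (simp add: vimage_def Int_def conj_commute)
  qed
  have le: "measure ?Q (?P j) \<le> M / 4 * measure ?Q (?B j) + 1 / M * exp (lam\<^sup>2 * r / \<sigma>\<^sup>2)"
    if "j \<in> J" for j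
  proof -
    have "(\<lambda>p\<in>?S. w p + signal r lam (U j) p) \<in> space ?Q" for w
      by (simp add: noise_space_def space_PiM)
    then have eq: "?P j = (\<lambda>w. \<lambda>p\<in>?S. w p + signal r lam (U j) p) -` ?B j \<inter> space ?Q"
      by (auto simp: observe_signal)
    \<comment> \<open>The choice \<open>t = 2 / M\<close> balances the terms: summed over all
      hypotheses, each contributes at most \<open>M / 4\<close>.\<close>
    have "emeasure ?Q (?P j) \<le> ennreal (1 / (2 * (2 / M))) * emeasure ?Q (?B j)
        + ennreal (2 / M / 2 * exp ((\<Sum>p\<in>?S. (signal r lam (U j) p)\<^sup>2) / \<sigma>\<^sup>2))"
      unfolding eq
      using gaussian_shift_emeasure_le[OF finite_upper_indices assms(1), of "2 / M" "?B j"
          n "signal r lam (U j)"] M B[OF that]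
      by (simp add: noise_space_def)
    also have "\<dots> \<le> ennreal (1 / (2 * (2 / M))) * emeasure ?Q (?B j)
        + ennreal (2 / M / 2 * exp (lam\<^sup>2 * r / \<sigma>\<^sup>2))"
      using sum_signal_square_le[OF U[OF that], of lam] M assms(1)
      by (intro add_left_mono ennreal_leI mult_left_mono) (auto intro: divide_right_mono)
    also have "\<dots> = ennreal (M / 4 * measure ?Q (?B j) + 1 / M * exp (lam\<^sup>2 * r / \<sigma>\<^sup>2))"
      using M by (simp add: Q.emeasure_eq_measure ennreal_mult'[symmetric])
    finally have "ennreal (measure ?Q (?P j))
        \<le> ennreal (M / 4 * measure ?Q (?B j) + 1 / M * exp (lam\<^sup>2 * r / \<sigma>\<^sup>2))"
      by (simp only: Q.emeasure_eq_measure)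
    then show ?thesis
      by (rule ennreal_le_iff[THEN iffD1, rotated]) (use M in simp)
  qed
  have "(\<Sum>j\<in>J. measure ?Q (?B j)) = measure ?Q (\<Union>j\<in>J. ?B j)"
    using disj B J(1) by (intro Q.finite_measure_finite_Union[symmetric])
      (auto simp: disjoint_family_on_def)
  also have "\<dots> \<le> 1" by simp
  finally have sumB: "(\<Sum>j\<in>J. measure ?Q (?B j)) \<le> 1" .
  have "M / 2 = (\<Sum>j\<in>J. 1 / 2)" by (simp add: M_def)
  also have "\<dots> < (\<Sum>j\<in>J. measure ?Q (?P j))"
    using J large by (intro sum_strict_mono) auto
  also have "\<dots> \<le> (\<Sum>j\<in>J. M / 4 * measure ?Q (?B j) + 1 / M * exp (lam\<^sup>2 * r / \<sigma>\<^sup>2))"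
    by (intro sum_mono le)
  also have "\<dots> = M / 4 * (\<Sum>j\<in>J. measure ?Q (?B j)) + exp (lam\<^sup>2 * r / \<sigma>\<^sup>2)"
    using M by (simp add: sum.distrib sum_distrib_left M_def)
  also have "\<dots> \<le> M / 4 * 1 + M / 4"
    using sumB M card by (intro add_mono mult_left_mono) (auto simp: M_def)
  finally show False by simp
qed

text \<open>An estimate outside the neighbourhood loses at least \<open>\<eta>\<close>, and under
  some hypothesis this happens with probability at least 1/2.\<close>

lemma SUP_risk_ge:
  assumes "0 < \<sigma>" "0 < \<eta>" "0 < n" "finite J" "J \<noteq> {}"
    and Uhat: "Uhat \<in> measurable (obs_space n) (est_space n r)"
    and U: "\<And>j. j \<in> J \<Longrightarrow> U j \<in> K_set n r \<mu>"
    and disj: "disjoint_family_on (\<lambda>j. near_set n r \<eta> (U j)) J"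
    and card: "4 * exp (lam\<^sup>2 * r / \<sigma>\<^sup>2) \<le> card J"
  shows "ennreal (\<eta> / 2) \<le> (SUP U \<in> K_set n r \<mu>. risk n r \<sigma> lam Uhat U)"
proof -
  let ?Q = "noise_space n \<sigma>"
  let ?A = "\<lambda>j. near_set n r \<eta> (U j) \<inter> space (est_space n r)"
  interpret Q: prob_space ?Q using assms(1) by (rule prob_space_noise)
  have "disjoint_family_on ?A J" using disj by (auto simp: disjoint_family_on_def)
  then obtain j where j: "j \<in> J" and le: "measure ?Q
      {w \<in> space ?Q. Uhat (observe n (signal r lam (U j)) w) \<in> ?A j} \<le> 1 / 2"
    using ex_hypothesis_missed[where A="?A" and U=U, OF assms(1,4,5) Uhat near_set_measurable _ _ card] U
    by (auto simp: K_set_def)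
  let ?P = "{w \<in> space ?Q. Uhat (observe n (signal r lam (U j)) w) \<in> ?A j}"
  have meas: "(\<lambda>w. Uhat (observe n (signal r lam (U j)) w)) \<in> measurable ?Q (est_space n r)"
    using measurable_compose[OF measurable_observe Uhat] .
  have P[measurable]: "?P \<in> sets ?Q"
    using measurable_sets[OF meas near_set_measurable[of n r \<eta> "U j"]]
    by (simp add: vimage_def Int_def conj_commute)
  have "ennreal (\<eta> / 2) \<le> ennreal (\<eta> * measure ?Q (space ?Q - ?P))"
    using le P assms(2) by (intro ennreal_leI) (simp add: Q.prob_compl)
  also have "\<dots> = (\<integral>\<^sup>+ w. ennreal \<eta> * indicator (space ?Q - ?P) w \<partial>?Q)"
    using P assms(2) by (simp add: nn_integral_cmult_indicator Q.emeasure_eq_measure ennreal_mult')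
  \<comment> \<open>The loss is bounded below pointwise by a measurable step function, so its own
    measurability is never invoked.\<close>
  also have "\<dots> \<le> risk n r \<sigma> lam Uhat (U j)"
    unfolding risk_def
  proof (rule nn_integral_mono)
    fix w assume w: "w \<in> space ?Q"
    show "ennreal \<eta> * indicator (space ?Q - ?P) w
        \<le> ennreal (d_2inf n r (Uhat (observe n (signal r lam (U j)) w)) (U j))"
    proof (cases "w \<in> ?P")
      case False
      then have "Uhat (observe n (signal r lam (U j)) w) \<notin> near_set n r \<eta> (U j)"
        using w measurable_space[OF meas w] by auto
      from d_2inf_ge[OF assms(3,2) this] show ?thesis
        by (auto simp: indicator_def intro: ennreal_leI)
    qed simp
  qed
  also have "\<dots> \<le> (SUP U \<in> K_set n r \<mu>. risk n r \<sigma> lam Uhat U)"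
    using U[OF j] by (rule SUP_upper)
  finally show ?thesis .
qed

text \<open>Independent choices from the packing in each block give at least
  \<open>2 powr (b * r^2 / 1024)\<close> hypotheses; the condition on \<open>b\<close> makes this
  reach \<open>4 * exp (lam^2 * r / \<sigma>^2)\<close>.\<close>

lemma SUP_risk_ge_blocks:
  assumes "1 \<le> r" "0 < \<sigma>" "Suc b * r \<le> n" "1 / real (Suc b) \<le> r * \<mu> / n"
    and Uhat: "Uhat \<in> measurable (obs_space n) (est_space n r)"
    and b: "2048 * (lam\<^sup>2 / \<sigma>\<^sup>2 + 2) \<le> real b * r"
  shows "ennreal (1 / (64 * sqrt (Suc b))) \<le> (SUP U \<in> K_set n r \<mu>. risk n r \<sigma> lam Uhat U)"
proof -
  obtain F where F: "finite F" "F \<subseteq> orth_group r"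
    "\<forall>A\<in>F. \<forall>B\<in>F. A \<noteq> B \<longrightarrow> real r / 48 \<le> frob_dist2 r A B"
    "2 powr (real r ^ 2 / 1024) \<le> card F"
    using orth_group_packing[OF assms(1)] by blast
  define J where "J = PiE {1..b} (\<lambda>_. F)"
  have orth: "\<Psi> \<beta> \<in> orth_group r" if "\<Psi> \<in> J" "\<beta> \<in> {1..b}" for \<Psi> \<beta>
    using that F(2) by (auto simp: J_def PiE_iff)
  have finJ: "finite J" unfolding J_def by (intro finite_PiE) (use F in auto)
  have "0 < 2 powr (real r ^ 2 / 1024)" by simp
  then have "F \<noteq> {}" using F(4) by auto
  then have neJ: "J \<noteq> {}" by (simp add: J_def PiE_eq_empty_iff)
  have cardJ: "real (card J) = real (card F) ^ b" by (simp add: J_def card_PiE)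
  have "4 * exp (lam\<^sup>2 * r / \<sigma>\<^sup>2) = exp (ln 4 + lam\<^sup>2 / \<sigma>\<^sup>2 * r)" by (simp add: exp_add)
  also have "\<dots> \<le> exp (ln 2 * (real b * r ^ 2 / 1024))"
  proof -
    \<comment> \<open>The term \<open>ln 4\<close> is absorbed by the additive 2 in the condition on
      \<open>b\<close>; the bound \<open>ln 2 >= 1 / 2\<close> below turns 1024 into 2048.\<close>
    have "ln 4 \<le> (2 :: real)" using ln_2_less_1 ln_realpow[of 2 2] by simp
    then have "ln 4 + lam\<^sup>2 / \<sigma>\<^sup>2 * r \<le> 2 * r + lam\<^sup>2 / \<sigma>\<^sup>2 * r" using assms(1) by simp
    also have "\<dots> = (lam\<^sup>2 / \<sigma>\<^sup>2 + 2) * r" by (simp add: algebra_simps)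
    also have "\<dots> \<le> (real b * r / 2048) * r"
    proof (rule mult_right_mono)
      show "lam\<^sup>2 / \<sigma>\<^sup>2 + 2 \<le> real b * r / 2048"
        using b by (simp only: pos_le_divide_eq zero_less_numeral mult.commute)
    qed simp
    also have "\<dots> = 1 / 2 * (real b * r ^ 2 / 1024)" by (simp add: power2_eq_square)
    also have "\<dots> \<le> ln 2 * (real b * r ^ 2 / 1024)"
      using ln2_ge_two_thirds by (intro mult_right_mono) auto
    finally show ?thesis by simp
  qed
  also have "\<dots> = (2 powr (real r ^ 2 / 1024)) ^ b"
    by (simp add: powr_def mult_ac flip: exp_of_nat_mult)
  also have "\<dots> \<le> card J" unfolding cardJ using F(4) by (intro power_mono) auto
  finally have card: "4 * exp (lam\<^sup>2 * r / \<sigma>\<^sup>2) \<le> card J" .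
  have "disjoint_family_on (\<lambda>\<Psi>. near_set n r (1 / (32 * sqrt (Suc b))) (block_mat r b \<Psi>)) J"
    unfolding disjoint_family_on_def
  proof (intro ballI impI)
    fix \<Psi> \<Phi> assume *: "\<Psi> \<in> J" "\<Phi> \<in> J" "\<Psi> \<noteq> \<Phi>"
    then obtain \<beta> where \<beta>: "\<beta> \<in> {1..b}" "\<Psi> \<beta> \<noteq> \<Phi> \<beta>"
      unfolding J_def by (meson PiE_ext)
    have "real r / 48 \<le> frob_dist2 r (\<Psi> \<beta>) (\<Phi> \<beta>)"
      using F(3) \<beta> * by (auto simp: J_def PiE_iff)
    then show "near_set n r (1 / (32 * sqrt (Suc b))) (block_mat r b \<Psi>)
        \<inter> near_set n r (1 / (32 * sqrt (Suc b))) (block_mat r b \<Phi>) = {}"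
      using block_mat_separated[where \<Psi>=\<Psi> and \<Phi>=\<Phi>, OF assms(1,3) \<beta>(1) orth[OF *(1) \<beta>(1)]] by force
  qed
  moreover have "block_mat r b \<Psi> \<in> K_set n r \<mu>" if "\<Psi> \<in> J" for \<Psi>
    using block_mat_in_K_set[OF assms(1,3) _ assms(4)] orth[OF that] by blast
  moreover have "0 < n" using assms(1,3) by (cases n) auto
  ultimately have "ennreal (1 / (32 * sqrt (Suc b)) / 2) \<le> (SUP U \<in> K_set n r \<mu>. risk n r \<sigma> lam Uhat U)"
    using finJ neJ card assms(2) Uhat by (intro SUP_risk_ge[where J=J and U="block_mat r b"]) auto
  then show ?thesis by simp
qed

theorem theorem2:
  "\<exists>C0 > 0. \<exists>c > 0. \<exists>N :: nat. \<forall>n \<ge> N. \<forall>(r :: nat) (\<mu> :: real) (\<sigma> :: real) (lam :: real).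
     1 \<le> r \<longrightarrow> 0 < \<mu> \<longrightarrow> 0 < \<sigma> \<longrightarrow>
     real n / \<mu> \<ge> max 4 (real r) \<longrightarrow> \<mu> \<ge> 12 * ln (12 * real n) \<longrightarrow>
     0 < lam \<longrightarrow> lam \<le> \<sigma> * sqrt (real n) / (6 * sqrt C0) \<longrightarrow>
     (INF Uhat \<in> measurable (obs_space n) (est_space n r).
        SUP U \<in> K_set n r \<mu>. risk n r \<sigma> lam Uhat U)
       \<ge> ennreal (c * min (\<sigma> * sqrt (real r) / lam)
                         (sqrt (\<mu> * real r / (real n * ln (real n / \<mu>)))))"
proof (rule exI[of _ "200 :: real"], rule conjI, simp, rule exI[of _ "1 / 4200 :: real"], rule conjI,
    simp, rule exI[of _ "nat \<lceil>exp (400 :: real)\<rceil>"], intro allI impI)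
  fix n r :: nat and \<mu> \<sigma> lam :: real
  assume n: "nat \<lceil>exp (400 :: real)\<rceil> \<le> n" and r: "1 \<le> r" and \<mu>: "0 < \<mu>" and \<sigma>: "0 < \<sigma>"
    and n\<mu>: "max 4 (real r) \<le> real n / \<mu>" and \<mu>_ge: "12 * ln (12 * real n) \<le> \<mu>"
    and lam: "0 < lam" "lam \<le> \<sigma> * sqrt (real n) / (6 * sqrt 200)"
  \<comment> \<open>\<open>x\<close> bounds from below the number of nonzero rows of an incoherent
    matrix; \<open>y\<close> is the squared signal-to-noise ratio.\<close>
  define x y where "x = real n / \<mu>" and "y = lam\<^sup>2 / \<sigma>\<^sup>2"
  have x: "4 \<le> x" "real r \<le> x" and y: "0 < y" using n\<mu> lam \<sigma> by (auto simp: x_def y_def)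
  have n0: "exp 400 \<le> real n" using n by linarith
  have npos: "0 < real n" using n0 exp_gt_zero[of 400] by linarith
  have "400 \<le> ln (12 * real n)"
    using n0 npos by (subst ln_ge_iff) auto
  then have "4800 \<le> \<mu>" using \<mu>_ge by linarith
  then have x_le: "x \<le> real n / 4800"
    unfolding x_def using npos by (intro divide_left_mono) auto
  have y_le: "y \<le> real n / 7200"
  proof -
    have "lam\<^sup>2 \<le> (\<sigma> * sqrt (real n) / (6 * sqrt 200))\<^sup>2"
      using lam by (intro power_mono) auto
    also have "\<dots> = \<sigma>\<^sup>2 * (real n / 7200)"
      by (simp add: power_divide power_mult_distrib)
    finally show ?thesis using \<sigma> by (simp add: y_def field_simps)
  qed
  \<comment> \<open>One \<open>b\<close> serves both purposes: the summand \<open>x\<close> covers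
    incoherence and, as \<open>x >= 4\<close>, also the additive 2 in the counting
    condition.\<close>
  define T where "T = 2048 * (y + x)"
  define b where "b = nat \<lceil>T / r\<rceil>"
  have T: "0 < T" using x y by (simp add: T_def)
  have "T / r \<le> b" "b \<le> T / r + 1" using T r by (auto simp: b_def)
  then have b1: "T \<le> real b * r" and b2: "real b * r \<le> T + r"
    using r by (auto simp: field_simps)
  \<comment> \<open>Rounding up and the identity block cost \<open>r <= x\<close> rows each, hence
    2050 in place of 2048.\<close>
  have size: "real (Suc b * r) \<le> 2050 * (y + x)"
    using b2 x y by (simp add: T_def algebra_simps)
  \<comment> \<open>Here \<open>2050 / 7200 + 2050 / 4800 < 1\<close>, with
    \<open>7200 = (6 * sqrt 200)^2\<close> from \<open>C0 = 200\<close> and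
    \<open>4800 = 12 * 400\<close> from \<open>n >= exp 400\<close>.\<close>
  also have "\<dots> \<le> n" using x_le y_le npos by simp
  finally have size_n: "Suc b * r \<le> n" by linarith
  have "x \<le> real (Suc b) * r" using b1 x y by (simp add: T_def algebra_simps)
  then have incoh: "1 / real (Suc b) \<le> r * \<mu> / n"
    using \<mu> npos by (simp add: x_def field_simps)
  have hyp: "2048 * (lam\<^sup>2 / \<sigma>\<^sup>2 + 2) \<le> real b * r"
    using b1 x unfolding T_def y_def by simp
  let ?m = "min (\<sigma> * sqrt (real r) / lam) (sqrt (\<mu> * real r / (real n * ln (real n / \<mu>))))"
  have "1 / 4200 * ?m \<le> 1 / (64 * sqrt (Suc b))"
  proof -
    \<comment> \<open>The logarithm is at least 1, so dropping it can only increase the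
      minimum.\<close>
    have "exp 1 \<le> (4 :: real)" using exp_le by linarith
    then have "1 \<le> ln x" using x by (subst ln_ge_iff) auto
    then have "\<mu> * real r / (real n * ln x) \<le> \<mu> * real r / (real n * 1)"
      using \<mu> npos by (intro divide_left_mono mult_left_mono mult_pos_pos) auto
    also have "\<dots> = r / x" by (simp add: x_def)
    finally have m1: "?m \<le> sqrt (r / x)"
      unfolding x_def[symmetric] by (intro min.coboundedI2 real_sqrt_le_mono)
    have "\<sigma> * sqrt (real r) / lam = sqrt (r / y)"
      using lam \<sigma> by (simp add: y_def real_sqrt_divide real_sqrt_mult)
    then have m2: "?m \<le> sqrt (r / y)" by simp
    \<comment> \<open>The larger of \<open>x\<close> and \<open>y\<close> is at least half of their
      sum.\<close>
    have "?m \<le> sqrt (2 * real r / (y + x))"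
    proof (cases "x \<le> y")
      case True
      then have "r / y \<le> 2 * real r / (y + x)" using x y r by (simp add: field_simps)
      then show ?thesis using m2 real_sqrt_le_mono order_trans by blast
    next
      case False
      then have "r / x \<le> 2 * real r / (y + x)" using x y r by (simp add: field_simps)
      then show ?thesis using m1 real_sqrt_le_mono order_trans by blast
    qed
    also have "\<dots> \<le> sqrt (4100 / real (Suc b))"
    proof (rule real_sqrt_le_mono)
      have "2 * real r * real (Suc b) \<le> 4100 * (y + x)" using size by (simp add: algebra_simps)
      then show "2 * real r / (y + x) \<le> 4100 / real (Suc b)"
        using x y by (simp only: divide_le_eq) (simp add: field_simps)
    qed
    also have "\<dots> = sqrt 4100 / sqrt (Suc b)" by (rule real_sqrt_divide)
    \<comment> \<open>\<open>65^2 = 4225\<close> exceeds 4100, and \<open>64 * 65 = 4160\<close>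
      fits below the 4200 in \<open>c\<close>.\<close>
    also have "\<dots> \<le> 65 / sqrt (Suc b)"
      by (intro divide_right_mono real_le_lsqrt) auto
    finally have "1 / 4200 * ?m \<le> 1 / 4200 * (65 / sqrt (Suc b))" by simp
    also have "\<dots> \<le> 1 / (64 * sqrt (Suc b))" by (simp add: field_simps)
    finally show ?thesis .
  qed
  then have "ennreal (1 / 4200 * ?m) \<le> ennreal (1 / (64 * sqrt (Suc b)))" by (rule ennreal_leI)
  also have "\<dots> \<le> (INF Uhat \<in> measurable (obs_space n) (est_space n r).
      SUP U \<in> K_set n r \<mu>. risk n r \<sigma> lam Uhat U)"
    by (intro INF_greatest SUP_risk_ge_blocks r \<sigma> size_n incoh hyp)
  finally show "ennreal (1 / 4200 * ?m) \<le> (INF Uhat \<in> measurable (obs_space n) (est_space n r).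
      SUP U \<in> K_set n r \<mu>. risk n r \<sigma> lam Uhat U)" .
qed

end
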